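(* Let $\tau$ be a partition of $N$ with $l:=\ell(\tau)\ge2$ and $\alpha=(1^{\tau_l},0^{N-\tau_l})$. Then $\zeta_{\alpha,T_1}$ is singular for $\kappa=\frac{1}{h_\tau}$: its coefficients (rational functions of $\kappa$) have no pole at $\kappa=1/h_\tau$, and its specialization at $\kappa=1/h_\tau$ satisfies $\mathcal{D}_i\zeta_{\alpha,T_1}=0$ for all $1\le i\le N$ (with the Dunkl operators taken at $\kappa=1/h_\tau$).
   Context: $\tau$ is a partition of $N$ with length $\ell(\tau)$; the hook-length of node $(i,j)$ is $h(i,j)=\tau_i-j+\#\{k\colon i<k\le\ell(\tau),\ j\le\tau_k\}+1$, and $h_\tau=h(1,1)=\tau_1+\ell(\tau)-1$. $\mathcal{Y}(\tau)$ is the set of reverse standard Young tableaux (fillings of the Ferrers diagram with $1,\dots,N$ decreasing along rows and columns); $c(i,T)=\operatorname{col}(i,T)-\operatorname{row}(i,T)$; $T_1\in\mathcal{Y}(\tau)$ is obtained by entering $N,N-1,\dots,1$ row by row. $V_\tau$ is the $\mathbb{R}(\kappa)$-space with basis $\mathcal{Y}(\tau)$ and representation $\tau$ of $\mathcal{S}_N$ given on $s_i=(i,i+1)$ by: $\tau(s_i)T=T$ if $i,i+1$ share a row; $-T$ if they share a column; $T^{(i)}+\frac1bT$ if $b=c(i,T)-c(i+1,T)\ge2$; $(1-\frac1{b^2})T^{(i)}+\frac1bT$ if $b\le-2$ ($T^{(i)}$: $i,i+1$ interchanged). $\mathcal{P}_\tau=\mathcal{P}\otimes V_\tau$ with $\mathcal{S}_N$-action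 $w(x^\beta\otimes T)=(xw)^\beta\otimes\tau(w)T$, $(xw)_i=x_{w(i)}$. $\mathcal{D}_i(p\otimes T)=\frac{\partial p}{\partial x_i}\otimes T+\kappa\sum_{j\ne i}\frac{p(x)-p(x(i,j))}{x_i-x_j}\otimes\tau((i,j))T$; $\mathcal{U}_i(p\otimes T)=\mathcal{D}_i(x_ip\otimes T)-\kappa\sum_{j<i}p(x(i,j))\otimes\tau((i,j))T$. For $\beta\in\mathbb{N}_0^N$: $\beta^+$ is its nonincreasing rearrangement, rank $r_\beta(i)=\#\{j\colon\beta_j>\beta_i\}+\#\{j\le i\colon\beta_j=\beta_i\}$. $\beta\prec\gamma$ iff $\beta\ne\gamma$ and $\sum_{j\le i}\beta_j\le\sum_{j\le i}\gamma_j$ for all $i$; $\beta\lhd\gamma$ iff $|\beta|=|\gamma|$ and ($\beta^+\prec\gamma^+$ or ($\beta^+=\gamma^+$ and $\beta\prec\gamma$)). The nonsymmetric Jack polynomial $\zeta_{\beta,T}$ is the unique element of $\mathcal{P}_\tau$ (for indeterminate $\kappa$) of the form $x^\beta\otimes\tau(r_\beta^{-1})T+\sum_{\gamma\lhd\beta}x^\gamma\otimes t_{\beta\gamma}(\kappa)$ with $\mathcal{U}_i\zeta_{\beta,T}=(\beta_i+1+\kappa c(r_\beta(i),T))\zeta_{\beta,T}$ for all $i$. *)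

theory Defs
  imports "HOL-Computational_Algebra.Polynomial" "HOL-Computational_Algebra.Fraction_Field"
begin

(* Tableaux are maps from cells (row, column), 1-indexed, to entries; 0 outside the diagram. *)
type_synonym tab = "nat \<times> nat \<Rightarrow> nat"
(* Elements of V_tau: coefficient functions on tableaux (supported on Y(tau)). *)
type_synonym 'a vec = "tab \<Rightarrow> 'a"
(* Elements of P_tau = P (x) V_tau: exponent vector beta (support in {1..N}) \<mapsto> vector coefficient. *)
type_synonym 'a ptau = "(nat \<Rightarrow> nat) \<Rightarrow> tab \<Rightarrow> 'a"

definition is_partition :: "nat \<Rightarrow> nat list \<Rightarrow> bool" where
  "is_partition N \<tau> \<longleftrightarrow> sorted_wrt (\<ge>) \<tau> \<and> (\<forall>x\<in>set \<tau>. 0 < x) \<and> sum_list \<tau> = N"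

definition cells :: "nat list \<Rightarrow> (nat \<times> nat) set" where
  "cells \<tau> = {(i,j). 1 \<le> i \<and> i \<le> length \<tau> \<and> 1 \<le> j \<and> j \<le> \<tau> ! (i - 1)}"

definition hook_length :: "nat list \<Rightarrow> nat \<times> nat \<Rightarrow> nat" where
  "hook_length \<tau> c = (case c of (i,j) \<Rightarrow>
     \<tau> ! (i - 1) - j + card {k. i < k \<and> k \<le> length \<tau> \<and> j \<le> \<tau> ! (k - 1)} + 1)"

definition h_tau :: "nat list \<Rightarrow> nat" where
  "h_tau \<tau> = hook_length \<tau> (1,1)"

definition RSYT :: "nat \<Rightarrow> nat list \<Rightarrow> tab set" where
  "RSYT N \<tau> = {T. bij_betw T (cells \<tau>) {1..N} \<and> (\<forall>c. c \<notin> cells \<tau> \<longrightarrow> T c = 0) \<and>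
     (\<forall>i j. (i,j) \<in> cells \<tau> \<and> (i,Suc j) \<in> cells \<tau> \<longrightarrow> T (i,Suc j) < T (i,j)) \<and>
     (\<forall>i j. (i,j) \<in> cells \<tau> \<and> (Suc i,j) \<in> cells \<tau> \<longrightarrow> T (Suc i,j) < T (i,j))}"

definition entry_cell :: "nat list \<Rightarrow> tab \<Rightarrow> nat \<Rightarrow> nat \<times> nat" where
  "entry_cell \<tau> T k = (THE c. c \<in> cells \<tau> \<and> T c = k)"

definition content :: "nat list \<Rightarrow> tab \<Rightarrow> nat \<Rightarrow> int" where
  "content \<tau> T k = int (snd (entry_cell \<tau> T k)) - int (fst (entry_cell \<tau> T k))"

definition tswap :: "nat \<Rightarrow> tab \<Rightarrow> tab" where
  "tswap i T = (\<lambda>c. if T c = i then Suc i else if T c = Suc i then i else T c)"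

definition bvec :: "tab \<Rightarrow> ('a::field) vec" where
  "bvec T = (\<lambda>S. if S = T then 1 else 0)"

definition sgen :: "nat list \<Rightarrow> nat \<Rightarrow> tab \<Rightarrow> ('a::field) vec" where
  "sgen \<tau> i T =
    (let b = content \<tau> T i - content \<tau> T (Suc i) in
     if fst (entry_cell \<tau> T i) = fst (entry_cell \<tau> T (Suc i)) then bvec T
     else if snd (entry_cell \<tau> T i) = snd (entry_cell \<tau> T (Suc i)) then (\<lambda>S. - bvec T S)
     else if b \<ge> 2 then (\<lambda>S. bvec (tswap i T) S + (1 / of_int b) * bvec T S)
     else if b \<le> -2 then (\<lambda>S. (1 - 1 / (of_int b)^2) * bvec (tswap i T) S + (1 / of_int b) * bvec T S)
     else (\<lambda>S. 0))"

definition repS :: "nat \<Rightarrow> nat list \<Rightarrow> nat \<Rightarrow> ('a::field) vec \<Rightarrow> 'a vec" where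
  "repS N \<tau> i v = (\<lambda>S. \<Sum>T\<in>RSYT N \<tau>. v T * sgen \<tau> i T S)"

definition tr :: "nat \<Rightarrow> nat \<Rightarrow> nat \<Rightarrow> nat" where
  "tr a b = (\<lambda>k. if k = a then b else if k = b then a else k)"

definition word_perm :: "nat list \<Rightarrow> nat \<Rightarrow> nat" where
  "word_perm ws = foldr (\<lambda>i f. tr i (Suc i) \<circ> f) ws id"

definition rep_word :: "nat \<Rightarrow> nat list \<Rightarrow> nat list \<Rightarrow> ('a::field) vec \<Rightarrow> 'a vec" where
  "rep_word N \<tau> ws v = foldr (\<lambda>i w. repS N \<tau> i w) ws v"

definition rep_perm :: "nat \<Rightarrow> nat list \<Rightarrow> (nat \<Rightarrow> nat) \<Rightarrow> ('a::field) vec \<Rightarrow> 'a vec" where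
  "rep_perm N \<tau> w v = rep_word N \<tau> (SOME ws. set ws \<subseteq> {1..<N} \<and> word_perm ws = w) v"

definition Ptau :: "nat \<Rightarrow> nat list \<Rightarrow> ('a::field) ptau \<Rightarrow> bool" where
  "Ptau N \<tau> f \<longleftrightarrow> finite {\<beta>. \<exists>T. f \<beta> T \<noteq> 0} \<and>
     (\<forall>\<beta> T. f \<beta> T \<noteq> 0 \<longrightarrow> (\<forall>k. \<beta> k \<noteq> 0 \<longrightarrow> k \<in> {1..N}) \<and> T \<in> RSYT N \<tau>)"

definition mapV :: "('a vec \<Rightarrow> 'a vec) \<Rightarrow> 'a ptau \<Rightarrow> 'a ptau" where
  "mapV g f = (\<lambda>\<beta>. g (f \<beta>))"

definition swapvars :: "nat \<Rightarrow> nat \<Rightarrow> 'a ptau \<Rightarrow> 'a ptau" where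
  "swapvars i j f = (\<lambda>\<beta>. f (\<beta> \<circ> tr i j))"

definition mulx :: "nat \<Rightarrow> ('a::field) ptau \<Rightarrow> 'a ptau" where
  "mulx i f = (\<lambda>\<beta> T. if \<beta> i = 0 then 0 else f (\<beta>(i := \<beta> i - 1)) T)"

definition dx :: "nat \<Rightarrow> ('a::field) ptau \<Rightarrow> 'a ptau" where
  "dx i f = (\<lambda>\<beta> T. of_nat (Suc (\<beta> i)) * f (\<beta>(i := Suc (\<beta> i))) T)"

definition ddiff :: "nat \<Rightarrow> nat list \<Rightarrow> nat \<Rightarrow> nat \<Rightarrow> ('a::field) ptau \<Rightarrow> 'a ptau" where
  "ddiff N \<tau> i j f = (THE g. Ptau N \<tau> g \<and>
     (\<forall>\<beta> T. mulx i g \<beta> T - mulx j g \<beta> T = f \<beta> T - swapvars i j f \<beta> T))"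

definition Dunkl :: "nat \<Rightarrow> nat list \<Rightarrow> ('a::field) \<Rightarrow> nat \<Rightarrow> 'a ptau \<Rightarrow> 'a ptau" where
  "Dunkl N \<tau> \<kappa> i f = (\<lambda>\<beta> T. dx i f \<beta> T +
     \<kappa> * (\<Sum>j\<in>{1..N} - {i}. mapV (rep_perm N \<tau> (tr i j)) (ddiff N \<tau> i j f) \<beta> T))"

definition Ucal :: "nat \<Rightarrow> nat list \<Rightarrow> ('a::field) \<Rightarrow> nat \<Rightarrow> 'a ptau \<Rightarrow> 'a ptau" where
  "Ucal N \<tau> \<kappa> i f = (\<lambda>\<beta> T. Dunkl N \<tau> \<kappa> i (mulx i f) \<beta> T -
     \<kappa> * (\<Sum>j\<in>{1..<i}. mapV (rep_perm N \<tau> (tr i j)) (swapvars i j f) \<beta> T))"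

definition rank :: "nat \<Rightarrow> (nat \<Rightarrow> nat) \<Rightarrow> nat \<Rightarrow> nat" where
  "rank N \<beta> i = card {j \<in> {1..N}. \<beta> i < \<beta> j} + card {j \<in> {1..i}. \<beta> j = \<beta> i}"

definition rank_perm :: "nat \<Rightarrow> (nat \<Rightarrow> nat) \<Rightarrow> nat \<Rightarrow> nat" where
  "rank_perm N \<beta> = (\<lambda>i. if i \<in> {1..N} then rank N \<beta> i else i)"

(* beta^+ : nonincreasing rearrangement, beta^+(r_beta(i)) = beta(i) *)
definition plus_part :: "nat \<Rightarrow> (nat \<Rightarrow> nat) \<Rightarrow> nat \<Rightarrow> nat" where
  "plus_part N \<beta> = (\<lambda>k. if k \<in> {1..N} then \<beta> (inv (rank_perm N \<beta>) k) else 0)"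

definition dom_prec :: "nat \<Rightarrow> (nat \<Rightarrow> nat) \<Rightarrow> (nat \<Rightarrow> nat) \<Rightarrow> bool" where
  "dom_prec N \<beta> \<gamma> \<longleftrightarrow> \<beta> \<noteq> \<gamma> \<and> (\<forall>i\<in>{1..N}. (\<Sum>j=1..i. \<beta> j) \<le> (\<Sum>j=1..i. \<gamma> j))"

definition dom_lhd :: "nat \<Rightarrow> (nat \<Rightarrow> nat) \<Rightarrow> (nat \<Rightarrow> nat) \<Rightarrow> bool" where
  "dom_lhd N \<beta> \<gamma> \<longleftrightarrow> (\<Sum>j=1..N. \<beta> j) = (\<Sum>j=1..N. \<gamma> j) \<and>
     (dom_prec N (plus_part N \<beta>) (plus_part N \<gamma>) \<or>
      (plus_part N \<beta> = plus_part N \<gamma> \<and> dom_prec N \<beta> \<gamma>))"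

definition is_nsJack :: "nat \<Rightarrow> nat list \<Rightarrow> ('a::field) \<Rightarrow> (nat \<Rightarrow> nat) \<Rightarrow> tab \<Rightarrow> 'a ptau \<Rightarrow> bool" where
  "is_nsJack N \<tau> \<kappa> \<beta> T \<zeta> \<longleftrightarrow> Ptau N \<tau> \<zeta> \<and>
     \<zeta> \<beta> = rep_perm N \<tau> (inv (rank_perm N \<beta>)) (bvec T) \<and>
     (\<forall>\<gamma>. \<gamma> \<noteq> \<beta> \<and> (\<exists>S. \<zeta> \<gamma> S \<noteq> 0) \<longrightarrow> dom_lhd N \<gamma> \<beta>) \<and>
     (\<forall>i\<in>{1..N}. Ucal N \<tau> \<kappa> i \<zeta> =
        (\<lambda>\<gamma> S. (of_nat (\<beta> i) + 1 + \<kappa> * of_int (content \<tau> T (rank N \<beta> i))) * \<zeta> \<gamma> S))"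

(* T_1: N, N-1, ..., 1 entered row by row *)
definition T1 :: "nat list \<Rightarrow> tab" where
  "T1 \<tau> = (\<lambda>(i,j). if (i,j) \<in> cells \<tau> then sum_list \<tau> - sum_list (take (i - 1) \<tau>) - (j - 1) else 0)"

definition alpha :: "nat list \<Rightarrow> nat \<Rightarrow> nat" where
  "alpha \<tau> = (\<lambda>k. if 1 \<le> k \<and> k \<le> last \<tau> then 1 else 0)"

definition kappa_indet :: "real poly fract" where
  "kappa_indet = Fract [:0, 1:] 1"

definition regular_at :: "real \<Rightarrow> real poly fract \<Rightarrow> bool" where
  "regular_at x r \<longleftrightarrow> (\<exists>p q. poly q x \<noteq> 0 \<and> r = Fract p q)"

definition eval_at :: "real \<Rightarrow> real poly fract \<Rightarrow> real" where
  "eval_at x r = (THE v. \<exists>p q. poly q x \<noteq> 0 \<and> r = Fract p q \<and> v = poly p x / poly q x)"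

end

(*
A multilinear element of P_tau of degree m is a family of vectors in V_tau indexed by the 0/1
exponents beta with m ones, and zeta is of this kind with m = last tau.  On such a family the
eigenvalue equation for U_i at an exponent with beta_i = 0 and i <= m expresses the coefficient at
beta through coefficients at exponents closer to alpha; the operator to be inverted is
1 + kappa (c(i,T_1) - J) with J conjugate to a Jucys-Murphy element.  The eigenvalues of J are
contents of tau, so the inverse has no pole at kappa_0 = 1 / h_tau, and the equations for i <= m
determine the specialisation at kappa_0.

At kappa_0 the same equations hold for a family obtained by Frobenius reciprocity: let sigma be
tau with its last row moved to the end of the first row.  Both V_sigma and V_tau contain the vectors
in which 1, ..., m fill the moved row, and the projection V_sigma -> V_tau onto them commutes with
S_m x S_(N-m).  The S_N-map it induces sends the tableau corresponding to T_1 to a family on which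
the i-th Jucys-Murphy element omega_i acts as c(i,T_1) + alpha_i h_tau, the content in sigma.  By
uniqueness it is the specialisation of zeta, and comparing the eigenvalues of U_i and of omega_i,
using U_i = x_i D_i + 1 + kappa omega_i, gives D_i zeta = 0.
*)
theory Submission
  imports Defs "HOL-Combinatorics.Permutations"
begin

section \<open>Tableaux and the seminormal form\<close>

text \<open>The constant comes from contents: carrying the cell (l,c) to (1,a+c), where a is the
  length of the first row, raises its content by a + l - 1 = h_tau. Times kappa_0 this is 1, exactly
  the excess of the eigenvalue of U_i at the places with alpha_i = 1. The obstacle is that not every
  eigenvalue equation can be solved at kappa_0. For i <= m and beta_i = 0, the eigenvalue to be
  inverted is, up to the factor h_tau, equal to h_tau + c(i,T_1) - c with a content c <= a - 1,
  hence at least m + 1 - i > 0. For i > m the summand 1 is missing, and c(i,T_1) - J can be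
  singular. The recursion therefore uses i <= m only, and the induced family is tested only against
  these equations. The equations for U_i that the last comparison needs are not checked for it: it
  inherits them from zeta once it is known to be the specialisation. Two definitions must be made
  computable beforehand: the representation, given by an arbitrary choice of a word, and the
  difference quotient, given by a definite description.\<close>

lemma cells_down:
  assumes "is_partition N \<tau>" "(r',c') \<in> cells \<tau>" "1 \<le> r" "r \<le> r'" "1 \<le> c" "c \<le> c'"
  shows "(r,c) \<in> cells \<tau>"
proof -
  have "\<tau> ! (r' - 1) \<le> \<tau> ! (r - 1)"
  proof (cases "r = r'")
    case False
    then have "r - 1 < r' - 1" "r' - 1 < length \<tau>" using assms by (auto simp: cells_def)
    with assms(1) show ?thesis
      by (auto simp: is_partition_def sorted_wrt_iff_nth_less)
  qed simp
  with assms show ?thesis by (auto simp: cells_def)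
qed

lemma finite_cells: "finite (cells \<tau>)"
proof (rule finite_subset)
  show "cells \<tau> \<subseteq> (SIGMA i:{1..length \<tau>}. {1..\<tau> ! (i - 1)})"
    by (auto simp: cells_def)
qed auto

lemma finite_RSYT: "finite (RSYT N \<tau>)"
proof (rule finite_subset)
  show "RSYT N \<tau> \<subseteq> {T. \<forall>c. (c \<in> cells \<tau> \<longrightarrow> T c \<in> {1..N}) \<and> (c \<notin> cells \<tau> \<longrightarrow> T c = 0)}"
    by (auto simp: RSYT_def bij_betw_def)
  show "finite {T. \<forall>c. (c \<in> cells \<tau> \<longrightarrow> T c \<in> {1..N}) \<and> (c \<notin> cells \<tau> \<longrightarrow> T c = (0::nat))}"
    by (rule finite_set_of_finite_funs) (auto simp: finite_cells)
qed

lemma entry_cell_eqI: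
  assumes "T \<in> RSYT N \<tau>" "c \<in> cells \<tau>" "T c = k"
  shows "entry_cell \<tau> T k = c"
  unfolding entry_cell_def
  using assms by (intro the_equality) (auto simp: RSYT_def bij_betw_def dest: inj_onD)

lemma entry_cell:
  assumes "T \<in> RSYT N \<tau>" "k \<in> {1..N}"
  shows "entry_cell \<tau> T k \<in> cells \<tau>" "T (entry_cell \<tau> T k) = k"
proof -
  obtain c where "c \<in> cells \<tau>" "T c = k"
    using assms unfolding RSYT_def bij_betw_def by (smt (verit) imageE mem_Collect_eq)
  with entry_cell_eqI[OF assms(1)]
  show "entry_cell \<tau> T k \<in> cells \<tau>" "T (entry_cell \<tau> T k) = k" by auto
qed

lemma RSYT_row: "T \<in> RSYT N \<tau> \<Longrightarrow> (i,j) \<in> cells \<tau> \<Longrightarrow> (i,Suc j) \<in> cells \<tau> \<Longrightarrow> T (i,Suc j) < T (i,j)"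
  and RSYT_col: "T \<in> RSYT N \<tau> \<Longrightarrow> (i,j) \<in> cells \<tau> \<Longrightarrow> (Suc i,j) \<in> cells \<tau> \<Longrightarrow> T (Suc i,j) < T (i,j)"
  and RSYT_outside: "T \<in> RSYT N \<tau> \<Longrightarrow> c \<notin> cells \<tau> \<Longrightarrow> T c = 0"
  and RSYT_bij: "T \<in> RSYT N \<tau> \<Longrightarrow> bij_betw T (cells \<tau>) {1..N}"
  by (cases c; simp add: RSYT_def)+

lemma RSYT_inj:
  "T \<in> RSYT N \<tau> \<Longrightarrow> c \<in> cells \<tau> \<Longrightarrow> c' \<in> cells \<tau> \<Longrightarrow> T c = T c' \<Longrightarrow> c = c'"
  using RSYT_bij[of T N \<tau>] by (auto simp: bij_betw_def dest: inj_onD)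

lemma RSYT_range: "T \<in> RSYT N \<tau> \<Longrightarrow> c \<in> cells \<tau> \<Longrightarrow> T c \<in> {1..N}"
  using RSYT_bij[of T N \<tau>] by (auto simp: bij_betw_def)

lemma cells_pos: "(r,c) \<in> cells \<tau> \<Longrightarrow> 1 \<le> r \<and> 1 \<le> c"
  by (auto simp: cells_def)

lemma RSYT_antimono:
  assumes P: "is_partition N \<tau>" and T: "T \<in> RSYT N \<tau>"
    and c: "(r',c') \<in> cells \<tau>" "1 \<le> r" "r \<le> r'" "1 \<le> c" "c \<le> c'"
  shows "T (r',c') \<le> T (r,c)"
proof -
  have "T (r,c') \<le> T (r,c)"
    using c(5) c(1)
  proof (induction c' rule: dec_induct)
    case (step n)
    have "(r,Suc n) \<in> cells \<tau>" "(r,n) \<in> cells \<tau>" "(r',n) \<in> cells \<tau>"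
      using step.hyps c step.prems by (auto intro: cells_down[OF P step.prems])
    with RSYT_row[OF T] step show ?case by fastforce
  qed simp
  moreover have "T (r',c') \<le> T (r,c')"
    using c(3) c(1)
  proof (induction r' rule: dec_induct)
    case (step n)
    have "(n,c') \<in> cells \<tau>"
      using step.hyps c step.prems by (auto intro: cells_down[OF P step.prems])
    with RSYT_col[OF T] step show ?case by fastforce
  qed simp
  ultimately show ?thesis by simp
qed

lemma RSYT_strict_antimono:
  assumes P: "is_partition N \<tau>" and T: "T \<in> RSYT N \<tau>"
    and c: "(r',c') \<in> cells \<tau>" "1 \<le> r" "r \<le> r'" "1 \<le> c" "c \<le> c'" "(r,c) \<noteq> (r',c')"
  shows "T (r',c') < T (r,c)"
  using RSYT_antimono[OF assms(1-7)] RSYT_inj[OF T c(1) cells_down[OF P c(1-5)]] c(6)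
  by fastforce

section \<open>Axial distances between neighbouring entries\<close>

definition axial :: "nat list \<Rightarrow> tab \<Rightarrow> nat \<Rightarrow> int" where
  "axial \<tau> T i = content \<tau> T i - content \<tau> T (Suc i)"

text \<open>Entries decrease to the right and downwards, so the cell of \<open>i\<close> is not
  weakly above and left of that of \<open>Suc i\<close>. If it were strictly below and right, or if
  there were a gap between the two in a common row or column, some entry would lie strictly between
  \<open>i\<close> and \<open>Suc i\<close>. Otherwise one cell is below and left of the other,
  which makes the distance at least 2. So the last branch of \<open>sgen\<close> is never reached on
  a standard tableau.\<close>

lemma axial_cases:
  assumes P: "is_partition N \<tau>" and T: "T \<in> RSYT N \<tau>" and i: "1 \<le> i" "i < N"
  obtains
    (row) "fst (entry_cell \<tau> T i) = fst (entry_cell \<tau> T (Suc i))"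
      "snd (entry_cell \<tau> T i) = Suc (snd (entry_cell \<tau> T (Suc i)))" "axial \<tau> T i = 1"
  | (col) "snd (entry_cell \<tau> T i) = snd (entry_cell \<tau> T (Suc i))"
      "fst (entry_cell \<tau> T i) = Suc (fst (entry_cell \<tau> T (Suc i)))" "axial \<tau> T i = -1"
  | (far) "fst (entry_cell \<tau> T i) \<noteq> fst (entry_cell \<tau> T (Suc i))"
      "snd (entry_cell \<tau> T i) \<noteq> snd (entry_cell \<tau> T (Suc i))"
      "axial \<tau> T i \<ge> 2 \<or> axial \<tau> T i \<le> -2"
proof -
  obtain r' c' where e1: "entry_cell \<tau> T i = (r',c')" by fastforce
  obtain r c where e2: "entry_cell \<tau> T (Suc i) = (r,c)" by fastforce
  have a: "(r',c') \<in> cells \<tau>" "T (r',c') = i" "(r,c) \<in> cells \<tau>" "T (r,c) = Suc i"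
    using entry_cell[OF T, of i] entry_cell[OF T, of "Suc i"] i by (auto simp: e1 e2)
  note p = cells_pos[OF a(1)] cells_pos[OF a(3)]
  have ne: "(r,c) \<noteq> (r',c')" using a by auto
  have b: "axial \<tau> T i = (int c' - int r') - (int c - int r)"
    by (simp add: axial_def content_def e1 e2)
  have nle: "\<not> (r' \<le> r \<and> c' \<le> c)"
    using RSYT_antimono[OF P T a(3), of r' c'] a p by auto
  consider "r = r'" "c < c'" | "c = c'" "r < r'" | "r < r'" "c < c'" | "r < r'" "c' < c" | "r' < r" "c < c'"
    using nle ne by fastforce
  then show thesis
  proof cases
    case 1
    have "c' = Suc c"
    proof (rule ccontr)
      assume "c' \<noteq> Suc c"
      with 1 have "Suc c < c'" by simp
      then have "T (r,c') < T (r,Suc c)" "T (r,Suc c) < T (r,c)"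
        using a(1,3) p 1 by (auto intro!: RSYT_strict_antimono[OF P T] intro: cells_down[OF P a(1)])
      with a 1 show False by simp
    qed
    with 1 b row show ?thesis by (auto simp: e1 e2)
  next
    case 2
    have "r' = Suc r"
    proof (rule ccontr)
      assume "r' \<noteq> Suc r"
      with 2 have "Suc r < r'" by simp
      then have "T (r',c) < T (Suc r,c)" "T (Suc r,c) < T (r,c)"
        using a(1,3) p 2 by (auto intro!: RSYT_strict_antimono[OF P T] intro: cells_down[OF P a(1)])
      with a 2 show False by simp
    qed
    with 2 b col show ?thesis by (auto simp: e1 e2)
  next
    case 3
    then have "T (r',c') < T (r,c')" "T (r,c') < T (r,c)"
      using a(1,3) p 3 by (auto intro!: RSYT_strict_antimono[OF P T] intro: cells_down[OF P a(1)])
    with a show ?thesis by simp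
  next
    case 4
    with b far show ?thesis by (auto simp: e1 e2)
  next
    case 5
    with b far show ?thesis by (auto simp: e1 e2)
  qed
qed

lemma axial_nonzero:
  "is_partition N \<tau> \<Longrightarrow> T \<in> RSYT N \<tau> \<Longrightarrow> 1 \<le> i \<Longrightarrow> i < N \<Longrightarrow> axial \<tau> T i \<noteq> 0"
  by (erule (3) axial_cases) auto

text \<open>Equal contents would put \<open>i\<close> diagonally below \<open>i + 2\<close>, and
  then the cells to the right of and below \<open>i + 2\<close> would both have to hold
  \<open>i + 1\<close>. The braid relation divides by this content difference.\<close>

lemma content_two_apart:
  assumes P: "is_partition N \<tau>" and T: "T \<in> RSYT N \<tau>" and i: "1 \<le> i" "Suc i < N"
  shows "content \<tau> T i \<noteq> content \<tau> T (Suc (Suc i))"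
proof
  assume eq: "content \<tau> T i = content \<tau> T (Suc (Suc i))"
  obtain r' c' where e1: "entry_cell \<tau> T i = (r',c')" by fastforce
  obtain r c where e2: "entry_cell \<tau> T (Suc (Suc i)) = (r,c)" by fastforce
  have a: "(r',c') \<in> cells \<tau>" "T (r',c') = i" "(r,c) \<in> cells \<tau>" "T (r,c) = Suc (Suc i)"
    using entry_cell[OF T, of i] entry_cell[OF T, of "Suc (Suc i)"] i by (auto simp: e1 e2)
  note p = cells_pos[OF a(1)] cells_pos[OF a(3)]
  have d: "int c' - int r' = int c - int r" using eq by (simp add: content_def e1 e2)
  have "\<not> (r' \<le> r \<and> c' \<le> c)"
    using RSYT_antimono[OF P T a(3), of r' c'] a p by auto
  with d have l: "r < r'" "c < c'" by auto
  have k: "(Suc r, c) \<in> cells \<tau>" "(r, Suc c) \<in> cells \<tau>"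
    using l p by (auto intro: cells_down[OF P a(1)])
  have "T (Suc r, c) < T (r,c)" "T (r, Suc c) < T (r,c)" "T (r',c') < T (Suc r, c)" "T (r',c') < T (r, Suc c)"
    using k p a(1,3) l by (auto intro!: RSYT_strict_antimono[OF P T])
  with a have "T (Suc r, c) = T (r, Suc c)" by simp
  with RSYT_inj[OF T k] show False by simp
qed

lemma tswap_tr: "tswap i T c = tr i (Suc i) (T c)"
  by (simp add: tswap_def tr_def)

lemma tr_tr [simp]: "tr a b (tr a b k) = k"
  by (simp add: tr_def)

lemma tr_tr_comp [simp]: "tr a b \<circ> tr a b = id"
  by (simp add: fun_eq_iff)

lemma tr_eq_iff: "tr a b k = l \<longleftrightarrow> k = tr a b l"
  by (metis tr_tr)

lemma tswap_tswap [simp]: "tswap i (tswap i T) = T"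
  by (simp add: fun_eq_iff tswap_tr)

lemma tswap_eq_iff: "tswap i T = S \<longleftrightarrow> T = tswap i S"
  by auto

lemma entry_cell_tswap: "entry_cell \<tau> (tswap i T) k = entry_cell \<tau> T (tr i (Suc i) k)"
  by (simp add: entry_cell_def tswap_tr tr_eq_iff)

lemma content_tswap: "content \<tau> (tswap i T) k = content \<tau> T (tr i (Suc i) k)"
  by (simp add: content_def entry_cell_tswap)

lemma axial_tswap [simp]: "axial \<tau> (tswap i T) i = - axial \<tau> T i"
  by (simp add: axial_def content_tswap tr_def)

text \<open>The swap reverses only the comparison between the cells of \<open>i\<close> and
  \<open>Suc i\<close>, and at axial distance at least 2 these share neither a row nor a
  column.\<close>

lemma tswap_RSYT:
  assumes P: "is_partition N \<tau>" and T: "T \<in> RSYT N \<tau>" and i: "1 \<le> i" "i < N"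
    and b: "axial \<tau> T i \<ge> 2 \<or> axial \<tau> T i \<le> -2"
  shows "tswap i T \<in> RSYT N \<tau>"
proof -
  have bij: "bij_betw (tr i (Suc i)) {1..N} {1..N}"
    using i by (intro bij_betw_byWitness[where f' = "tr i (Suc i)"]) (auto simp: tr_def)
  have far: "fst (entry_cell \<tau> T i) \<noteq> fst (entry_cell \<tau> T (Suc i))"
      "snd (entry_cell \<tau> T i) \<noteq> snd (entry_cell \<tau> T (Suc i))"
    using axial_cases[OF P T i] b by fastforce+
  have step: "tr i (Suc i) (T d) < tr i (Suc i) (T c)"
    if "c \<in> cells \<tau>" "d \<in> cells \<tau>" "T d < T c" "fst c = fst d \<or> snd c = snd d" for c d
  proof -
    have "\<not> (T d = i \<and> T c = Suc i)"
      using entry_cell_eqI[OF T that(1)] entry_cell_eqI[OF T that(2)] far that(4) by auto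
    with that(3) show ?thesis by (auto simp: tr_def)
  qed
  have "bij_betw (\<lambda>c. tr i (Suc i) (T c)) (cells \<tau>) {1..N}"
    using bij_betw_trans[OF RSYT_bij[OF T] bij] by (simp add: comp_def)
  moreover have tr0: "tr i (Suc i) 0 = 0" using i by (simp add: tr_def)
  moreover have "tswap i T = (\<lambda>c. tr i (Suc i) (T c))" by (simp add: fun_eq_iff tswap_tr)
  ultimately show ?thesis
    using T i tr0 by (auto simp: RSYT_def intro!: step)
qed

section \<open>Young's seminormal form and the Coxeter relations of its generators\<close>

definition offdiag :: "int \<Rightarrow> 'a::field" where
  "offdiag b = (if b \<ge> 2 then 1 else if b \<le> -2 then 1 - 1 / (of_int b)^2 else 0)"

lemma offdiag_nonzero: "offdiag b \<noteq> 0 \<Longrightarrow> b \<ge> 2 \<or> b \<le> -2"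
  by (auto simp: offdiag_def split: if_splits)

text \<open>The normalisation of the seminormal form depends on the sign of \<open>b\<close>, but
  the square and braid relations need only this product, which does not. For \<open>b = 1\<close>
  and \<open>b = -1\<close> both sides vanish.\<close>

lemma offdiag_mult:
  "b \<noteq> 0 \<Longrightarrow> offdiag b * offdiag (- b) = 1 - 1 / (of_int b)^2"
  by (cases "b = 1 \<or> b = -1") (auto simp: offdiag_def)

lemma sgen_uniform:
  assumes P: "is_partition N \<tau>" and T: "T \<in> RSYT N \<tau>" and i: "1 \<le> i" "i < N"
  shows "sgen \<tau> i T S = offdiag (axial \<tau> T i) * bvec (tswap i T) S + 1 / of_int (axial \<tau> T i) * bvec T S"
  using P T i
proof (cases rule: axial_cases)
  case far
  then show ?thesis by (auto simp: sgen_def offdiag_def axial_def Let_def)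
qed (auto simp: sgen_def offdiag_def axial_def[symmetric] Let_def)

text \<open>The actual V_tau inside the type \<open>vec\<close>. Since \<open>repS\<close> discards
  coefficients off \<open>RSYT\<close>, its square is the identity only on this subspace.\<close>

definition Vspace :: "nat \<Rightarrow> nat list \<Rightarrow> ('a::field) vec set" where
  "Vspace N \<tau> = {v. \<forall>T. T \<notin> RSYT N \<tau> \<longrightarrow> v T = 0}"

text \<open>
  The coefficient of \<^term>\<open>S\<close> in the image of \<^term>\<open>v\<close>, read as an operator on functions of arbitrary fillings.
  Since \<^term>\<open>offdiag\<close> vanishes whenever the swapped filling is not standard, the relations between the
  generators become identities in the contents, without cases for missing tableaux.
\<close>
definition young_op :: "nat list \<Rightarrow> nat \<Rightarrow> ('a::field) vec \<Rightarrow> 'a vec" where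
  "young_op \<tau> i v S = v S / of_int (axial \<tau> S i) + offdiag (- axial \<tau> S i) * v (tswap i S)"

text \<open>Passing from images of basis vectors to coefficients transposes the matrix. This turns
  \<open>offdiag b\<close> into \<open>offdiag (- b)\<close>, as the swapped tableau has the
  opposite axial distance.\<close>

lemma repS_eval:
  assumes P: "is_partition N \<tau>" and S: "S \<in> RSYT N \<tau>" and i: "1 \<le> i" "i < N"
    and v: "v \<in> Vspace N \<tau>"
  shows "repS N \<tau> i v S = young_op \<tau> i v S"
proof -
  have "repS N \<tau> i v S = (\<Sum>T\<in>RSYT N \<tau>. (if tswap i S = T then v T * offdiag (axial \<tau> T i) else 0)
      + (if S = T then v T / of_int (axial \<tau> T i) else 0))"
    unfolding repS_def
    by (intro sum.cong refl) (auto simp: sgen_uniform[OF P _ i] bvec_def tswap_eq_iff algebra_simps)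
  also have "\<dots> = young_op \<tau> i v S"
    using S v by (auto simp: sum.distrib finite_RSYT young_op_def Vspace_def)
  finally show ?thesis .
qed

lemma repS_Vspace:
  assumes P: "is_partition N \<tau>" and i: "1 \<le> i" "i < N"
  shows "repS N \<tau> i v \<in> Vspace N \<tau>"
proof -
  have "sgen \<tau> i T S = (0::'a)" if "T \<in> RSYT N \<tau>" "S \<notin> RSYT N \<tau>" for T S
    using tswap_RSYT[OF P that(1) i] that
    by (auto simp: sgen_uniform[OF P that(1) i] bvec_def dest: offdiag_nonzero)
  then show ?thesis by (auto simp: Vspace_def repS_def)
qed

text \<open>Values at nonstandard fillings are met only with coefficient 0. Hence
  \<open>repS\<close> may be replaced by \<open>young_op\<close> inside iterated applications as
  well.\<close>

lemma young_op_cong: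
  assumes P: "is_partition N \<tau>" and S: "S \<in> RSYT N \<tau>" and i: "1 \<le> i" "i < N"
    and vw: "\<And>T. T \<in> RSYT N \<tau> \<Longrightarrow> v T = w T"
  shows "young_op \<tau> i v S = young_op \<tau> i w S"
proof (cases "offdiag (- axial \<tau> S i) = (0::'a)")
  case False
  then have "tswap i S \<in> RSYT N \<tau>"
    by (intro tswap_RSYT[OF P S i]) (auto dest!: offdiag_nonzero)
  with vw S show ?thesis by (simp add: young_op_def)
qed (use vw S in \<open>simp add: young_op_def\<close>)

lemma Vspace_eqI:
  "v \<in> Vspace N \<tau> \<Longrightarrow> w \<in> Vspace N \<tau> \<Longrightarrow> (\<And>S. S \<in> RSYT N \<tau> \<Longrightarrow> v S = w S) \<Longrightarrow> v = w"
  by (force simp: Vspace_def)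

lemma repS_square:
  fixes v :: "('a::field_char_0) vec"
  assumes P: "is_partition N \<tau>" and i: "1 \<le> i" "i < N" and v: "v \<in> Vspace N \<tau>"
  shows "repS N \<tau> i (repS N \<tau> i v) = v"
proof (rule Vspace_eqI[OF repS_Vspace[OF P i] v])
  fix S assume S: "S \<in> RSYT N \<tau>"
  define b where "b = axial \<tau> S i"
  have b: "b \<noteq> 0" unfolding b_def by (rule axial_nonzero[OF P S i])
  have "repS N \<tau> i (repS N \<tau> i v) S = young_op \<tau> i (young_op \<tau> i v) S"
    unfolding repS_eval[OF P S i repS_Vspace[OF P i]]
    by (rule young_op_cong[OF P S i]) (rule repS_eval[OF P _ i v])
  also have "\<dots> = (1 / (of_int b)^2 + offdiag b * offdiag (- b)) * v S"
    using b by (simp add: young_op_def b_def[symmetric] field_simps power2_eq_square)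
  finally show "repS N \<tau> i (repS N \<tau> i v) S = v S"
    by (simp add: offdiag_mult[OF b])
qed

text \<open>Both sides combine the values of \<open>v\<close> at the six fillings obtained from
  \<open>S\<close> by the two swaps. At the three fillings that need two or three swaps the
  coefficients agree outright; at the other three they agree by the identity \<open>pqr\<close> and
  the products \<open>AA\<close>.\<close>

lemma young_op_braid:
  fixes v :: "('a::field_char_0) vec"
  assumes "content \<tau> S i \<noteq> content \<tau> S (Suc i)" "content \<tau> S (Suc i) \<noteq> content \<tau> S (Suc (Suc i))"
    "content \<tau> S i \<noteq> content \<tau> S (Suc (Suc i))"
  shows "young_op \<tau> i (young_op \<tau> (Suc i) (young_op \<tau> i v)) S =
    young_op \<tau> (Suc i) (young_op \<tau> i (young_op \<tau> (Suc i) v)) S"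
proof -
  define x y z where "x = content \<tau> S i" and "y = content \<tau> S (Suc i)" and "z = content \<tau> S (Suc (Suc i))"
  define p q r :: 'a where "p = 1 / of_int (x - y)" and "q = 1 / of_int (y - z)" and "r = 1 / of_int (x - z)"
  define A B C A' B' C' :: 'a where "A = offdiag (x - y)" and "B = offdiag (y - z)" and "C = offdiag (x - z)"
    and "A' = offdiag (y - x)" and "B' = offdiag (z - y)" and "C' = offdiag (z - x)"
  let ?s = "tswap i" and ?t = "tswap (Suc i)"
  have sts: "?s (?t (?s S)) = ?t (?s (?t S))"
    by (simp add: fun_eq_iff tswap_def)
  note ne = assms[folded x_def y_def z_def]
  have neg: "1 / of_int (y - x) = - p" "1 / of_int (z - y) = - q" "1 / of_int (z - x) = - r"
    unfolding p_def q_def r_def by (metis minus_diff_eq of_int_minus minus_divide_right)+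
  have nz: "of_int x - of_int y \<noteq> (0::'a)" "of_int y - of_int z \<noteq> (0::'a)" "of_int x - of_int z \<noteq> (0::'a)"
    using ne by auto
  \<comment> \<open>Partial fractions: this is (x - y) + (y - z) = x - z divided by the product of
    the three differences.\<close>
  have pqr: "p * q = r * (p + q)"
    using nz unfolding p_def q_def r_def of_int_diff by (simp add: divide_simps)
  have AA: "A * A' = 1 - p^2" "B * B' = 1 - q^2"
    using offdiag_mult[of "x - y"] offdiag_mult[of "y - z"] ne
    by (simp_all add: A_def A'_def B_def B'_def p_def q_def power_one_over)
  have yo: "young_op \<tau> k w T = (1 / of_int (axial \<tau> T k)) * w T + offdiag (- axial \<tau> T k) * w (tswap k T)" for k and w :: "'a vec" and T
    by (simp add: young_op_def)
  have L: "young_op \<tau> i (young_op \<tau> (Suc i) (young_op \<tau> i v)) S =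
     p * (q * (p * v S + A' * v (?s S)) + B' * (r * v (?t S) + C' * v (?s (?t S)))) +
     A' * (r * (- p * v (?s S) + A * v S) + C' * (q * v (?t (?s S)) + B' * v (?s (?t (?s S)))))"
    unfolding yo by (simp add: axial_def content_tswap tr_def x_def[symmetric] y_def[symmetric] z_def[symmetric]
      p_def[symmetric] q_def[symmetric] r_def[symmetric] neg A_def[symmetric] B_def[symmetric] C_def[symmetric]
      A'_def[symmetric] B'_def[symmetric] C'_def[symmetric] del: of_int_diff)
  have R: "young_op \<tau> (Suc i) (young_op \<tau> i (young_op \<tau> (Suc i) v)) S =
     q * (p * (q * v S + B' * v (?t S)) + A' * (r * v (?s S) + C' * v (?t (?s S)))) +
     B' * (r * (- q * v (?t S) + B * v S) + C' * (p * v (?s (?t S)) + A' * v (?t (?s (?t S)))))"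
    unfolding yo by (simp add: axial_def content_tswap tr_def x_def[symmetric] y_def[symmetric] z_def[symmetric]
      p_def[symmetric] q_def[symmetric] r_def[symmetric] neg A_def[symmetric] B_def[symmetric] C_def[symmetric]
      A'_def[symmetric] B'_def[symmetric] C'_def[symmetric] del: of_int_diff)
  have "young_op \<tau> i (young_op \<tau> (Suc i) (young_op \<tau> i v)) S -
    young_op \<tau> (Suc i) (young_op \<tau> i (young_op \<tau> (Suc i) v)) S =
    (p * q * (p - q) + r * (A * A' - B * B')) * v S + A' * (p * q - r * (p + q)) * v (?s S)
    + B' * (r * (p + q) - p * q) * v (?t S)"
    unfolding L R sts by (simp add: algebra_simps)
  also have "\<dots> = 0"
    unfolding AA pqr by (simp add: algebra_simps power2_eq_square)
  finally show ?thesis by simp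
qed

lemma repS_braid:
  fixes v :: "('a::field_char_0) vec"
  assumes P: "is_partition N \<tau>" and i: "1 \<le> i" "Suc i < N" and v: "v \<in> Vspace N \<tau>"
  shows "repS N \<tau> i (repS N \<tau> (Suc i) (repS N \<tau> i v)) =
    repS N \<tau> (Suc i) (repS N \<tau> i (repS N \<tau> (Suc i) v))"
proof -
  have three: "repS N \<tau> a (repS N \<tau> b (repS N \<tau> c v)) S = young_op \<tau> a (young_op \<tau> b (young_op \<tau> c v)) S"
    if S: "S \<in> RSYT N \<tau>" and abc: "1 \<le> a" "a < N" "1 \<le> b" "b < N" "1 \<le> c" "c < N" for a b c S
  proof -
    have 1: "repS N \<tau> b (repS N \<tau> c v) S = young_op \<tau> b (young_op \<tau> c v) S" if S: "S \<in> RSYT N \<tau>" for S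
      unfolding repS_eval[OF P S abc(3,4) repS_Vspace[OF P abc(5,6)]]
      by (rule young_op_cong[OF P S abc(3,4)]) (rule repS_eval[OF P _ abc(5,6) v])
    show ?thesis
      unfolding repS_eval[OF P S abc(1,2) repS_Vspace[OF P abc(3,4)]]
      by (rule young_op_cong[OF P S abc(1,2)]) (rule 1)
  qed
  have i': "i < N" "1 \<le> Suc i" using i by auto
  show ?thesis
  proof (rule Vspace_eqI[OF repS_Vspace[OF P i(1) i'(1)] repS_Vspace[OF P i'(2) i(2)]])
    fix S assume S: "S \<in> RSYT N \<tau>"
    show "repS N \<tau> i (repS N \<tau> (Suc i) (repS N \<tau> i v)) S =
      repS N \<tau> (Suc i) (repS N \<tau> i (repS N \<tau> (Suc i) v)) S"
      unfolding three[OF S i(1) i'(1) i'(2) i(2) i(1) i'(1)] three[OF S i'(2) i(2) i(1) i'(1) i'(2) i(2)]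
      using axial_nonzero[OF P S i(1) i'(1)] axial_nonzero[OF P S i'(2) i(2)] content_two_apart[OF P S i]
      by (intro young_op_braid) (auto simp: axial_def)
  qed
qed

lemma repS_commute:
  fixes v :: "('a::field_char_0) vec"
  assumes P: "is_partition N \<tau>" and i: "1 \<le> i" "i < N" and j: "1 \<le> j" "j < N" and ij: "Suc i < j"
    and v: "v \<in> Vspace N \<tau>"
  shows "repS N \<tau> i (repS N \<tau> j v) = repS N \<tau> j (repS N \<tau> i v)"
proof (rule Vspace_eqI[OF repS_Vspace[OF P i] repS_Vspace[OF P j]])
  fix S assume S: "S \<in> RSYT N \<tau>"
  have "repS N \<tau> i (repS N \<tau> j v) S = young_op \<tau> i (young_op \<tau> j v) S"
    unfolding repS_eval[OF P S i repS_Vspace[OF P j]]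
    by (rule young_op_cong[OF P S i]) (rule repS_eval[OF P _ j v])
  moreover have "repS N \<tau> j (repS N \<tau> i v) S = young_op \<tau> j (young_op \<tau> i v) S"
    unfolding repS_eval[OF P S j repS_Vspace[OF P i]]
    by (rule young_op_cong[OF P S j]) (rule repS_eval[OF P _ i v])
  moreover have "tswap i (tswap j S) = tswap j (tswap i S)"
    using ij by (auto simp: fun_eq_iff tswap_def)
  moreover have "axial \<tau> (tswap i S) j = axial \<tau> S j" "axial \<tau> (tswap j S) i = axial \<tau> S i"
    using ij by (simp_all add: axial_def content_tswap tr_def)
  ultimately show "repS N \<tau> i (repS N \<tau> j v) S = repS N \<tau> j (repS N \<tau> i v) S"
    by (simp add: young_op_def add_divide_distrib algebra_simps)
qed

section \<open>Coxeter relations and words of permutations\<close>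

lemma tr_transpose: "tr a b = Transposition.transpose a b"
  by (simp add: fun_eq_iff tr_def Transposition.transpose_def)

lemma word_perm_Nil [simp]: "word_perm [] = id"
  and word_perm_Cons [simp]: "word_perm (i # ws) = tr i (Suc i) \<circ> word_perm ws"
  by (simp_all add: word_perm_def)

lemma word_perm_append: "word_perm (us @ ws) = word_perm us \<circ> word_perm ws"
  by (induction us) (simp_all add: comp_assoc)

lemma word_perm_rev: "word_perm (rev ws) \<circ> word_perm ws = id" "word_perm ws \<circ> word_perm (rev ws) = id"
proof -
  show 1: "word_perm (rev ws) \<circ> word_perm ws = id" for ws
  proof (induction ws)
    case (Cons i ws)
    have "word_perm (rev (i # ws)) \<circ> word_perm (i # ws)
      = word_perm (rev ws) \<circ> (tr i (Suc i) \<circ> tr i (Suc i)) \<circ> word_perm ws"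
      by (simp only: rev.simps word_perm_append word_perm_Cons word_perm_Nil comp_assoc comp_id)
    also have "\<dots> = id" unfolding tr_tr_comp comp_id by (rule Cons)
    finally show ?case .
  qed simp
  from this[of "rev ws"] show "word_perm ws \<circ> word_perm (rev ws) = id" by simp
qed

lemma tr_permutes: "a \<in> S \<Longrightarrow> b \<in> S \<Longrightarrow> tr a b permutes S"
  by (auto simp: permutes_def tr_def) metis+

lemma word_perm_permutes: "set ws \<subseteq> {a..<b} \<Longrightarrow> word_perm ws permutes {a..b}"
proof (induction ws)
  case (Cons i ws)
  then have "tr i (Suc i) permutes {a..b}" by (intro tr_permutes) auto
  moreover have "word_perm ws permutes {a..b}" using Cons by auto
  ultimately show ?case unfolding word_perm_Cons by (intro permutes_compose)
qed (simp add: permutes_id)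

lemma word_tr_less:
  assumes "a < b" shows "\<exists>ws. set ws \<subseteq> {a..<b} \<and> word_perm ws = tr a b"
  using assms
proof (induction b rule: less_Suc_induct)
  case (1 i)
  show ?case by (rule exI[of _ "[i]"]) simp
next
  case (2 i j k)
  then obtain us ws where u: "set us \<subseteq> {i..<j}" "word_perm us = tr i j" "set ws \<subseteq> {j..<k}" "word_perm ws = tr j k"
    by blast
  have "word_perm (us @ ws @ us) = tr i k"
    using 2 u by (auto simp: word_perm_append fun_eq_iff tr_def)
  with u 2 show ?case by (intro exI[of _ "us @ ws @ us"]) auto
qed

lemma tr_sym: "tr a b = tr b a"
  by (auto simp: tr_def)

lemma word_tr:
  assumes "a \<in> {c..d}" "b \<in> {c..d}" "a \<noteq> b"
  shows "\<exists>ws. set ws \<subseteq> {c..<d} \<and> word_perm ws = tr a b"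
proof -
  have "\<exists>ws. set ws \<subseteq> {min a b..<max a b} \<and> word_perm ws = tr (min a b) (max a b)"
    using assms by (intro word_tr_less) auto
  moreover have "tr (min a b) (max a b) = tr a b" by (auto simp: min_def max_def tr_sym)
  ultimately obtain ws where "set ws \<subseteq> {min a b..<max a b}" "word_perm ws = tr a b" by auto
  moreover have "{min a b..<max a b} \<subseteq> {c..<d}" using assms by auto
  ultimately show ?thesis by blast
qed

lemma word_exists:
  assumes "w permutes {c..d}"
  shows "\<exists>ws. set ws \<subseteq> {c..<d} \<and> word_perm ws = w"
  using assms finite_atLeastAtMost
proof (induction w rule: permutes_induct)
  case id
  show ?case by (rule exI[of _ "[]"]) simp
next
  case (swap a b p)
  then obtain ws where "set ws \<subseteq> {c..<d}" "word_perm ws = p" by blast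
  moreover obtain us where "set us \<subseteq> {c..<d}" "word_perm us = tr a b"
    using word_tr[of a c d b] swap by blast
  ultimately show ?case
    by (intro exI[of _ "us @ ws"]) (auto simp: word_perm_append tr_transpose)
qed

text \<open>The words n, n-1, ..., k for k = 1, ..., n+1, the last one empty, represent the right
  cosets of the symmetric group on n letters in that on n+1 letters: the permutation of
  \<open>desc n k\<close> sends \<open>k\<close> to \<open>Suc n\<close>.\<close>

definition desc :: "nat \<Rightarrow> nat \<Rightarrow> nat list" where
  "desc n k = rev [k..<Suc n]"

lemma desc_Nil: "desc n (Suc n) = []"
  by (simp add: desc_def)

lemma desc_snoc: "k \<le> n \<Longrightarrow> desc n (Suc k) @ [k] = desc n k"
  by (simp add: desc_def upt_conv_Cons del: upt_Suc)

lemma desc_split: "1 \<le> k \<Longrightarrow> k \<le> i \<Longrightarrow> i \<le> n \<Longrightarrow> desc n k = desc n (Suc i) @ i # desc (i - 1) k"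
proof -
  assume "1 \<le> k" "k \<le> i" "i \<le> n"
  then have "[k..<Suc n] = [k..<i] @ [i] @ [Suc i..<Suc n]"
    by (metis append_Cons append_Nil le_Suc_eq less_Suc_eq_le upt_conv_Cons upt_add_eq_append le_add_diff_inverse)
  moreover have "desc (i - 1) k = rev [k..<i]" using \<open>1 \<le> k\<close> \<open>k \<le> i\<close>
    by (cases i) (auto simp: desc_def)
  ultimately show ?thesis by (simp add: desc_def)
qed

lemma set_desc: "set (desc n k) = {k..n}"
  by (auto simp: desc_def)

text \<open>
  \<^term>\<open>rep_perm\<close> evaluates a permutation through an arbitrarily chosen word; that the choice is immaterial
  is the Coxeter presentation of the symmetric group.
\<close>
locale coxeter_action =
  fixes N :: nat and V :: "'v set" and R :: "nat \<Rightarrow> 'v \<Rightarrow> 'v"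
  assumes closed: "\<And>i v. 1 \<le> i \<Longrightarrow> i < N \<Longrightarrow> v \<in> V \<Longrightarrow> R i v \<in> V"
    and square: "\<And>i v. 1 \<le> i \<Longrightarrow> i < N \<Longrightarrow> v \<in> V \<Longrightarrow> R i (R i v) = v"
    and braid: "\<And>i v. 1 \<le> i \<Longrightarrow> Suc i < N \<Longrightarrow> v \<in> V \<Longrightarrow>
       R i (R (Suc i) (R i v)) = R (Suc i) (R i (R (Suc i) v))"
    and commute: "\<And>i j v. 1 \<le> i \<Longrightarrow> Suc i < j \<Longrightarrow> j < N \<Longrightarrow> v \<in> V \<Longrightarrow> R i (R j v) = R j (R i v)"
begin

abbreviation act :: "nat list \<Rightarrow> 'v \<Rightarrow> 'v" where
  "act \<equiv> foldr R"

text \<open>The permutation is tracked together with the action, so that after any rewriting the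
  coset of the word can still be read off.\<close>

definition word_eq :: "nat list \<Rightarrow> nat list \<Rightarrow> bool" where
  "word_eq us ws \<longleftrightarrow> set us \<subseteq> {1..<N} \<and> set ws \<subseteq> {1..<N} \<and> word_perm us = word_perm ws \<and> (\<forall>v\<in>V. act us v = act ws v)"

lemma act_closed: "set ws \<subseteq> {1..<N} \<Longrightarrow> v \<in> V \<Longrightarrow> act ws v \<in> V"
  by (induction ws) (auto intro: closed)

lemma word_eq_refl: "set us \<subseteq> {1..<N} \<Longrightarrow> word_eq us us"
  by (simp add: word_eq_def)

lemma word_eq_trans [trans]: "word_eq us ws \<Longrightarrow> word_eq ws xs \<Longrightarrow> word_eq us xs"
  by (simp add: word_eq_def)

lemma word_eq_append: "word_eq us us' \<Longrightarrow> word_eq ws ws' \<Longrightarrow> word_eq (us @ ws) (us' @ ws')"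
  by (auto simp: word_eq_def word_perm_append act_closed)

lemma word_eq_mid: "word_eq us us' \<Longrightarrow> set xs \<subseteq> {1..<N} \<Longrightarrow> set ys \<subseteq> {1..<N} \<Longrightarrow> word_eq (xs @ us @ ys) (xs @ us' @ ys)"
  by (intro word_eq_append word_eq_refl)

lemma word_eq_square: "1 \<le> i \<Longrightarrow> i < N \<Longrightarrow> word_eq [i,i] []"
  by (simp add: word_eq_def square)

lemma word_eq_braid: "1 \<le> i \<Longrightarrow> Suc i < N \<Longrightarrow> word_eq [Suc i, i, Suc i] [i, Suc i, i]"
  by (auto simp: word_eq_def braid fun_eq_iff tr_def)

lemma word_eq_comm: "1 \<le> i \<Longrightarrow> i < N \<Longrightarrow> 1 \<le> j \<Longrightarrow> j < N \<Longrightarrow> Suc i < j \<or> Suc j < i \<Longrightarrow> word_eq [i,j] [j,i]"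
  by (auto simp: word_eq_def fun_eq_iff tr_def intro: commute commute[symmetric])

lemma word_eq_comm_word:
  "1 \<le> i \<Longrightarrow> i < N \<Longrightarrow> set ws \<subseteq> {1..<N} \<Longrightarrow> (\<And>j. j \<in> set ws \<Longrightarrow> Suc i < j \<or> Suc j < i) \<Longrightarrow>
    word_eq (ws @ [i]) (i # ws)"
proof (induction ws)
  case (Cons j ws)
  have "word_eq ([j] @ (ws @ [i])) ([j] @ (i # ws))"
    using Cons by (intro word_eq_append word_eq_refl) auto
  also have "word_eq ([j] @ (i # ws)) (i # j # ws)"
    using word_eq_append[OF word_eq_comm[of j i] word_eq_refl[of ws]] Cons by auto
  finally show ?case by simp
qed (simp add: word_eq_refl)

text \<open>A generator multiplied from the right onto a coset representative extends the run if
  \<open>i = k - 1\<close>, cancels its last letter if \<open>i = k\<close>, and otherwise travels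
  to the left end: unchanged if \<open>i < k - 1\<close>, and as \<open>i - 1\<close>, through one
  braid move, if \<open>i > k\<close>.\<close>

lemma normal_form_step:
  assumes n: "n < N" and k: "1 \<le> k" "k \<le> Suc n" and i: "1 \<le> i" "i \<le> n"
  shows "\<exists>us k'. set us \<subseteq> {1..<n} \<and> 1 \<le> k' \<and> k' \<le> Suc n \<and> word_eq (desc n k @ [i]) (us @ desc n k')"
proof -
  have s: "set (desc n k) \<subseteq> {1..<N}" using k n by (auto simp: set_desc)
  consider "Suc i < k" | "Suc i = k" | "i = k" | "k < i" by linarith
  then show ?thesis
  proof cases
    case 1
    then have "word_eq (desc n k @ [i]) ([i] @ desc n k)"
      using word_eq_comm_word[of i "desc n k"] s i n by (auto simp: set_desc)
    with 1 k i show ?thesis by (intro exI[of _ "[i]"] exI[of _ k]) auto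
  next
    case 2
    then have "desc n k @ [i] = desc n i" using desc_snoc[of i n] i by simp
    with i n show ?thesis by (intro exI[of _ "[]"] exI[of _ i]) (auto intro!: word_eq_refl simp: set_desc)
  next
    case 3
    have "word_eq (desc n (Suc k) @ [k,k] @ []) (desc n (Suc k) @ [] @ [])"
      using 3 k i n by (intro word_eq_mid word_eq_square) (auto simp: set_desc)
    moreover have "desc n k @ [i] = desc n (Suc k) @ [k,k] @ []"
      using 3 i desc_snoc[of k n, symmetric] by simp
    ultimately show ?thesis using 3 i by (intro exI[of _ "[]"] exI[of _ "Suc k"]) auto
  next
    case 4
    define j where "j = i - 1"
    have j: "i = Suc j" "k \<le> j" "1 \<le> j" using 4 k by (auto simp: j_def)
    define xs where "xs = desc n (Suc i)"
    define ys where "ys = desc (j - 1) k"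
    have d: "desc n k = xs @ [i, j] @ ys"
      using desc_split[of k i n] desc_split[of k j "i - 1"] j i k by (simp add: xs_def ys_def desc_Nil)
    have ss: "set xs \<subseteq> {1..<N}" "set ys \<subseteq> {1..<N}" "i < N" "1 \<le> i" "j < N"
      using i k n j by (auto simp: xs_def ys_def set_desc)
    \<comment> \<open>The letters of \<open>ys\<close> are below \<open>j\<close>, so
      \<open>i\<close> passes them; \<open>i j i\<close> becomes \<open>j i j\<close>; the first
      \<open>j\<close> then passes \<open>xs\<close>, whose letters exceed \<open>i\<close>.\<close>
    have "word_eq ((xs @ [i,j]) @ (ys @ [i])) ((xs @ [i,j]) @ (i # ys))"
      using ss j by (intro word_eq_append word_eq_refl word_eq_comm_word) (auto simp: ys_def set_desc)
    also have "(xs @ [i,j]) @ (i # ys) = xs @ [i,j,i] @ ys" by simp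
    also have "word_eq \<dots> (xs @ [j,i,j] @ ys)"
      unfolding j(1) using ss j by (intro word_eq_mid word_eq_braid) auto
    also have "xs @ [j,i,j] @ ys = (xs @ [j]) @ ([i,j] @ ys)" by simp
    also have "word_eq \<dots> ((j # xs) @ ([i,j] @ ys))"
      using ss j by (intro word_eq_append word_eq_refl word_eq_comm_word) (auto simp: xs_def set_desc)
    also have "(j # xs) @ ([i,j] @ ys) = [j] @ desc n k" using d by simp
    finally have "word_eq (desc n k @ [i]) ([j] @ desc n k)" using d by simp
    with j i k show ?thesis by (intro exI[of _ "[j]"] exI[of _ k]) auto
  qed
qed

lemma normal_form:
  assumes n: "n < N" and ws: "set ws \<subseteq> {1..n}"
  shows "\<exists>us k. set us \<subseteq> {1..<n} \<and> 1 \<le> k \<and> k \<le> Suc n \<and> word_eq ws (us @ desc n k)"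
  using ws
proof (induction ws rule: rev_induct)
  case Nil
  show ?case by (intro exI[of _ "[]"] exI[of _ "Suc n"]) (simp add: desc_Nil word_eq_refl)
next
  case (snoc i ws)
  then obtain us k where u: "set us \<subseteq> {1..<n}" "1 \<le> k" "k \<le> Suc n" "word_eq ws (us @ desc n k)" by auto
  obtain us' k' where u': "set us' \<subseteq> {1..<n}" "1 \<le> k'" "k' \<le> Suc n" "word_eq (desc n k @ [i]) (us' @ desc n k')"
    using normal_form_step[OF n u(2,3), of i] snoc.prems by auto
  have "word_eq (ws @ [i]) ((us @ desc n k) @ [i])"
    using snoc.prems n by (intro word_eq_append u word_eq_refl) auto
  also have "(us @ desc n k) @ [i] = us @ (desc n k @ [i])" by simp
  also have "word_eq \<dots> (us @ (us' @ desc n k'))"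
    using u(1) n by (intro word_eq_append u' word_eq_refl) auto
  finally show ?case using u u' by (intro exI[of _ "us @ us'"] exI[of _ k']) auto
qed

lemma word_perm_desc: "k \<le> Suc n \<Longrightarrow> word_perm (desc n k) k = Suc n"
proof (induction "Suc n - k" arbitrary: k)
  case 0
  then have "k = Suc n" by simp
  then show ?case by (simp add: desc_Nil)
next
  case (Suc d)
  then have "word_perm (desc n (Suc k)) (Suc k) = Suc n" by simp
  then show ?case
    using Suc desc_snoc[of k n, symmetric] by (simp add: word_perm_append tr_def)
qed

text \<open>A word for the identity fixes the top point, and so does the part \<open>us\<close> of
  its normal form. Hence the run \<open>desc\<close> fixes it too and must be empty, and what
  remains is a word with one generator fewer.\<close>

lemma act_trivial:
  assumes "n < N" "set ws \<subseteq> {1..n}" "word_perm ws = id" "v \<in> V"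
  shows "act ws v = v"
  using assms
proof (induction n arbitrary: ws)
  case (Suc n)
  obtain us k where u: "set us \<subseteq> {1..<Suc n}" "1 \<le> k" "k \<le> Suc (Suc n)" "word_eq ws (us @ desc (Suc n) k)"
    using normal_form[OF Suc.prems(1,2)] by blast
  have id: "word_perm us \<circ> word_perm (desc (Suc n) k) = id"
    using u(4) Suc.prems(3) unfolding word_eq_def word_perm_append by metis
  have "word_perm us permutes {1..Suc n}" by (rule word_perm_permutes) (use u in auto)
  then have "word_perm us (Suc (Suc n)) = Suc (Suc n)" by (simp add: permutes_def)
  with id have "k = Suc (Suc n)"
    using word_perm_desc[OF u(3)] by (metis comp_apply id_apply)
  with id u have "word_perm us = id" "word_eq ws us" by (simp_all add: desc_Nil)
  moreover have "set us \<subseteq> {1..n}" using u(1) by auto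
  ultimately show ?case using Suc.IH[of us] Suc.prems by (simp add: word_eq_def)
qed simp

lemma act_eq:
  assumes us: "set us \<subseteq> {1..<N}" and ws: "set ws \<subseteq> {1..<N}" and eq: "word_perm us = word_perm ws" and v: "v \<in> V"
  shows "act us v = act ws v"
proof (cases "N = 0")
  case False
  then have triv: "act xs u = u" if "set xs \<subseteq> {1..<N}" "word_perm xs = id" "u \<in> V" for xs u
    using act_trivial[of "N - 1" xs u] that by fastforce
  have "act us v = act (us @ rev ws @ ws) v"
    using triv[of "rev ws @ ws"] ws v by (simp add: word_perm_append word_perm_rev)
  also have "\<dots> = act (us @ rev ws) (act ws v)" by simp
  also have "\<dots> = act ws v"
    using us ws v eq by (intro triv act_closed) (auto simp: word_perm_append word_perm_rev)
  finally show ?thesis .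
qed (use us ws in auto)

end

section \<open>The representation of the symmetric group and Jucys-Murphy elements\<close>

lemma coxeter_action_repS:
  "is_partition N \<tau> \<Longrightarrow> coxeter_action N (Vspace N \<tau> :: ('a::field_char_0) vec set) (repS N \<tau>)"
  by unfold_locales (auto intro: repS_Vspace repS_square repS_braid repS_commute)

lemma rep_word_Vspace:
  assumes "is_partition N \<tau>" "set ws \<subseteq> {1..<N}" "v \<in> Vspace N \<tau>"
  shows "rep_word N \<tau> ws v \<in> Vspace N \<tau>"
  using assms(2,3) by (induction ws) (auto simp: rep_word_def intro: repS_Vspace[OF assms(1)])

lemma rep_perm_word:
  fixes v :: "('a::field_char_0) vec"
  assumes P: "is_partition N \<tau>" and ws: "set ws \<subseteq> {1..<N}" and w: "word_perm ws = w" and v: "v \<in> Vspace N \<tau>"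
  shows "rep_perm N \<tau> w v = rep_word N \<tau> ws v"
proof -
  interpret coxeter_action N "Vspace N \<tau> :: 'a vec set" "repS N \<tau>"
    by (rule coxeter_action_repS[OF P])
  have "\<exists>ws. set ws \<subseteq> {1..<N} \<and> word_perm ws = w" using ws w by blast
  from someI_ex[OF this] show ?thesis
    unfolding rep_perm_def rep_word_def using ws w v by (intro act_eq) auto
qed

lemma rep_perm_Vspace:
  assumes P: "is_partition N \<tau>" and w: "w permutes {1..N}" and v: "v \<in> Vspace N \<tau>"
  shows "rep_perm N \<tau> w v \<in> Vspace N \<tau>"
  unfolding rep_perm_def
  using someI_ex[OF word_exists[OF w]] v by (intro rep_word_Vspace[OF P]) auto

lemma rep_perm_comp:
  fixes v :: "('a::field_char_0) vec"
  assumes P: "is_partition N \<tau>" and g: "g permutes {1..N}" and w: "w permutes {1..N}" and v: "v \<in> Vspace N \<tau>"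
  shows "rep_perm N \<tau> (g \<circ> w) v = rep_perm N \<tau> g (rep_perm N \<tau> w v)"
proof -
  obtain us where us: "set us \<subseteq> {1..<N}" "word_perm us = g" using word_exists[OF g] by blast
  obtain ws where ws: "set ws \<subseteq> {1..<N}" "word_perm ws = w" using word_exists[OF w] by blast
  have "rep_perm N \<tau> (g \<circ> w) v = rep_word N \<tau> (us @ ws) v"
    using us ws by (intro rep_perm_word[OF P _ _ v]) (auto simp: word_perm_append)
  also have "\<dots> = rep_word N \<tau> us (rep_word N \<tau> ws v)" by (simp add: rep_word_def)
  also have "rep_word N \<tau> ws v = rep_perm N \<tau> w v" using ws by (intro rep_perm_word[OF P _ _ v, symmetric])
  also have "rep_word N \<tau> us (rep_perm N \<tau> w v) = rep_perm N \<tau> g (rep_perm N \<tau> w v)"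
    using us by (intro rep_perm_word[OF P, symmetric] rep_perm_Vspace[OF P w v])
  finally show ?thesis .
qed

lemma rep_perm_id:
  fixes v :: "('a::field_char_0) vec"
  assumes "is_partition N \<tau>" "v \<in> Vspace N \<tau>"
  shows "rep_perm N \<tau> id v = v"
  using rep_perm_word[OF assms(1), of "[]" id v] assms(2) by (simp add: rep_word_def)

lemma rep_perm_simple:
  fixes v :: "('a::field_char_0) vec"
  assumes "is_partition N \<tau>" "v \<in> Vspace N \<tau>" "1 \<le> i" "i < N"
  shows "rep_perm N \<tau> (tr i (Suc i)) v = repS N \<tau> i v"
  using rep_perm_word[OF assms(1), of "[i]" _ v] assms by (simp add: rep_word_def)

lemma rep_perm_inverse:
  fixes v :: "('a::field_char_0) vec"
  assumes P: "is_partition N \<tau>" and w: "w permutes {1..N}" and v: "v \<in> Vspace N \<tau>"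
  shows "rep_perm N \<tau> w (rep_perm N \<tau> (inv w) v) = v" "rep_perm N \<tau> (inv w) (rep_perm N \<tau> w v) = v"
  using rep_perm_comp[OF P w permutes_inv[OF w] v] rep_perm_comp[OF P permutes_inv[OF w] w v]
  by (simp_all add: permutes_inv_o[OF w] rep_perm_id[OF P v])

lemma rep_word_lincomb:
  "rep_word N \<tau> ws (\<lambda>S. \<Sum>j\<in>J. c j * f j S) = (\<lambda>S. \<Sum>j\<in>J. c j * rep_word N \<tau> ws (f j) S)"
proof (induction ws)
  case (Cons i ws)
  have "(\<Sum>T\<in>A. (\<Sum>j\<in>J. c j * g j T) * h T) = (\<Sum>j\<in>J. c j * (\<Sum>T\<in>A. g j T * h T))" for g h and A :: "tab set"
    by (simp add: sum_distrib_left sum_distrib_right mult.assoc) (rule sum.swap)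
  with Cons show ?case by (simp add: rep_word_def repS_def)
qed (simp add: rep_word_def)

lemma rep_perm_lincomb:
  "rep_perm N \<tau> w (\<lambda>S. \<Sum>j\<in>J. c j * f j S) = (\<lambda>S. \<Sum>j\<in>J. c j * rep_perm N \<tau> w (f j) S)"
  unfolding rep_perm_def by (rule rep_word_lincomb)

lemma rep_perm_sum:
  "rep_perm N \<tau> w (\<lambda>S. \<Sum>j\<in>J. f j S) = (\<lambda>S. \<Sum>j\<in>J. rep_perm N \<tau> w (f j) S)"
  using rep_perm_lincomb[where c = "\<lambda>_. 1"] by simp

lemma rep_perm_scale: "rep_perm N \<tau> w (\<lambda>S. c * f S) = (\<lambda>S. c * rep_perm N \<tau> w f S)"
  using rep_perm_lincomb[where J = "{()}" and c = "\<lambda>_. c" and f = "\<lambda>_. f"] by simp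

lemma rep_perm_diff: "rep_perm N \<tau> w (\<lambda>S. f S - g S) = (\<lambda>S. rep_perm N \<tau> w f S - rep_perm N \<tau> w g S)"
  using rep_perm_lincomb[where J = "UNIV :: bool set" and c = "\<lambda>b. if b then 1 else -1" and f = "\<lambda>b. if b then f else g"]
  by (simp add: UNIV_bool algebra_simps)

lemma rep_perm_zero: "rep_perm N \<tau> w (\<lambda>S. 0) = (\<lambda>S. 0)"
  using rep_perm_scale[of N \<tau> w 0 "\<lambda>S. 0"] by simp

section \<open>Jucys-Murphy elements and their eigenvalues\<close>

lemma partition_cell_one:
  assumes "is_partition N \<tau>" "c \<in> cells \<tau>"
  shows "(1,1) \<in> cells \<tau>"
  using cells_down[OF assms(1), of "fst c" "snd c" 1 1] assms(2) cells_pos[of "fst c" "snd c"] by auto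

lemma entry_cell_top:
  assumes P: "is_partition N \<tau>" and T: "T \<in> RSYT N \<tau>" and N: "1 \<le> N"
  shows "entry_cell \<tau> T N = (1,1)"
proof -
  obtain r c where e: "entry_cell \<tau> T N = (r,c)" by fastforce
  have a: "(r,c) \<in> cells \<tau>" "T (r,c) = N" using entry_cell[OF T, of N] N e by auto
  note o = partition_cell_one[OF P a(1)]
  have "T (r,c) \<le> T (1,1)" using cells_pos[OF a(1)] by (intro RSYT_antimono[OF P T a(1)]) auto
  moreover have "T (1,1) \<le> N" using RSYT_range[OF T o] by simp
  ultimately show ?thesis using a o by (intro entry_cell_eqI[OF T]) auto
qed

text \<open>The sum runs over \<open>j > i\<close>, not \<open>j < i\<close>, because the corner of
  a reverse tableau holds \<open>N\<close>.\<close>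

definition jucys_murphy :: "nat \<Rightarrow> nat list \<Rightarrow> nat \<Rightarrow> ('a::field) vec \<Rightarrow> 'a vec" where
  "jucys_murphy N \<tau> i v = (\<lambda>S. \<Sum>j\<in>{i<..N}. rep_perm N \<tau> (tr i j) v S)"

text \<open>Downward induction with omega_i = s_i + s_i omega_(i+1) s_i. It starts at
  \<open>N\<close>, where the sum is empty and the content of the corner is 0.\<close>

lemma jucys_murphy_diagonal:
  fixes v :: "('a::field_char_0) vec"
  assumes P: "is_partition N \<tau>" and i: "1 \<le> i" "i \<le> N" and v: "v \<in> Vspace N \<tau>"
  shows "jucys_murphy N \<tau> i v S = of_int (content \<tau> S i) * v S"
proof -
  have "\<forall>v::'a vec. v \<in> Vspace N \<tau> \<longrightarrow> (\<forall>S. jucys_murphy N \<tau> i v S = of_int (content \<tau> S i) * v S)"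
    using i(2) i(1)
  proof (induction rule: inc_induct)
    case base
    then have "content \<tau> S N = 0" if "S \<in> RSYT N \<tau>" for S
      by (simp add: content_def entry_cell_top[OF P that])
    then show ?case by (auto simp: jucys_murphy_def Vspace_def)
  next
    case (step i)
    show ?case
    proof (intro allI impI)
      fix v :: "'a vec" and S
      assume v: "v \<in> Vspace N \<tau>"
      have i: "1 \<le> i" "i < N" "1 \<le> Suc i" using step by auto
      define w where "w = repS N \<tau> i v"
      have w: "w \<in> Vspace N \<tau>" unfolding w_def by (rule repS_Vspace[OF P i(1,2)])
      define u where "u = jucys_murphy N \<tau> (Suc i) w"
      have u_eq: "u S = of_int (content \<tau> S (Suc i)) * w S" for S
        using step.IH[OF i(3)] w by (simp add: u_def)
      have u: "u \<in> Vspace N \<tau>" using w by (simp add: Vspace_def u_eq)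
      have tr_i: "tr i (Suc i) permutes {1..N}" using i by (intro tr_permutes) auto
      have far: "rep_perm N \<tau> (tr i j) v = repS N \<tau> i (rep_perm N \<tau> (tr (Suc i) j) w)"
        if "j \<in> {Suc i<..N}" for j
      proof -
        have p: "tr (Suc i) j permutes {1..N}" using that by (intro tr_permutes) auto
        have "tr i j = tr i (Suc i) \<circ> (tr (Suc i) j \<circ> tr i (Suc i))"
          using that by (auto simp: fun_eq_iff tr_def)
        then have "rep_perm N \<tau> (tr i j) v = rep_perm N \<tau> (tr i (Suc i)) (rep_perm N \<tau> (tr (Suc i) j) (rep_perm N \<tau> (tr i (Suc i)) v))"
          by (simp add: rep_perm_comp[OF P tr_i permutes_compose[OF tr_i p] v] rep_perm_comp[OF P p tr_i v])
        also have "\<dots> = repS N \<tau> i (rep_perm N \<tau> (tr (Suc i) j) w)"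
          using rep_perm_simple[OF P rep_perm_Vspace[OF P p w] i(1,2)] rep_perm_simple[OF P v i(1,2)]
          by (simp add: w_def)
        finally show ?thesis .
      qed
      have split: "{i<..N} = insert (Suc i) {Suc i<..N}" using i by auto
      have "jucys_murphy N \<tau> i v S = w S + (\<Sum>j\<in>{Suc i<..N}. repS N \<tau> i (rep_perm N \<tau> (tr (Suc i) j) w) S)"
        unfolding jucys_murphy_def split by (simp add: far w_def rep_perm_simple[OF P v i(1,2)])
      also have "\<dots> = w S + repS N \<tau> i u S"
      proof -
        have "rep_perm N \<tau> (tr i (Suc i)) u = (\<lambda>S. \<Sum>j\<in>{Suc i<..N}. rep_perm N \<tau> (tr i (Suc i)) (rep_perm N \<tau> (tr (Suc i) j) w) S)"
          unfolding u_def jucys_murphy_def by (rule rep_perm_sum)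
        moreover have "rep_perm N \<tau> (tr i (Suc i)) (rep_perm N \<tau> (tr (Suc i) j) w) = repS N \<tau> i (rep_perm N \<tau> (tr (Suc i) j) w)"
          if "j \<in> {Suc i<..N}" for j
          using that by (intro rep_perm_simple[OF P _ i(1,2)] rep_perm_Vspace[OF P _ w] tr_permutes) auto
        ultimately show ?thesis by (simp add: rep_perm_simple[OF P u i(1,2)])
      qed
      also have "\<dots> = of_int (content \<tau> S i) * v S"
      proof (cases "S \<in> RSYT N \<tau>")
        case False
        with v w repS_Vspace[OF P i(1,2), of u] show ?thesis by (simp add: Vspace_def)
      next
        case S: True
        define x y where "x = content \<tau> S i" and "y = content \<tau> S (Suc i)"
        have ax: "axial \<tau> S i = x - y" by (simp add: axial_def x_def y_def)
        have nz: "of_int x - of_int y \<noteq> (0::'a)"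
          using axial_nonzero[OF P S i(1,2)] unfolding ax by auto
        \<comment> \<open>The relation s_i w = v eliminates the value of \<open>w\<close> at the
          swapped tableau, so no case distinction on that tableau being standard is required. The
          remaining \<open>- w S\<close> cancels the summand that comes from s_i alone.\<close>
        have "v S = repS N \<tau> i w S" unfolding w_def by (simp add: repS_square[OF P i(1,2) v])
        also have "\<dots> = w S / of_int (x - y) + offdiag (y - x) * w (tswap i S)"
          unfolding repS_eval[OF P S i(1,2) w] young_op_def ax by simp
        finally have vS: "offdiag (y - x) * w (tswap i S) = v S - w S / of_int (x - y)" by simp
        have "repS N \<tau> i u S = of_int y * w S / of_int (x - y) + of_int x * (offdiag (y - x) * w (tswap i S))"
          unfolding repS_eval[OF P S i(1,2) u] young_op_def ax
          by (simp add: u_eq content_tswap tr_def x_def y_def)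
        also have "\<dots> = of_int x * v S - w S"
        proof -
          have "(of_int x - of_int y) * (w S / of_int (x - y)) = w S" using nz by simp
          then show ?thesis
            unfolding vS by (simp add: algebra_simps diff_divide_distrib del: of_int_diff)
        qed
        finally show ?thesis by (simp add: x_def)
      qed
      finally show "jucys_murphy N \<tau> i v S = of_int (content \<tau> S i) * v S" .
    qed
  qed
  with v show ?thesis by blast
qed

section \<open>Sums of transpositions through one point\<close>

lemma conj_tr:
  assumes "w permutes A" shows "w \<circ> tr a b \<circ> inv w = tr (w a) (w b)"
proof
  fix x
  show "(w \<circ> tr a b \<circ> inv w) x = tr (w a) (w b) x"
    using permutes_inverses[OF assms] by (auto simp: tr_def)
qed

text \<open>Relabelling by \<open>w\<close> turns the sum of the transpositions (i j) over any set
  \<open>J\<close> into a Jucys-Murphy element; its index \<open>k\<close> is forced, since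
  \<open>k\<close> must have \<open>card J\<close> successors up to \<open>N\<close>. The recursion
  for zeta produces such sums with irregular \<open>J\<close>.\<close>

lemma sorting_perm_exists:
  fixes N :: nat
  assumes i: "i \<in> {1..N}" and J: "J \<subseteq> {1..N} - {i}"
  shows "\<exists>w k. w permutes {1..N} \<and> k \<in> {1..N} \<and> w k = i \<and> w ` {k<..N} = J"
proof -
  have fin: "finite J" by (rule finite_subset[OF J]) simp
  have "card J \<le> card ({1..N} - {i})" by (intro card_mono J) simp
  then have cJ: "card J < N" using i by (simp; linarith)
  define k where "k = N - card J"
  have k: "k \<in> {1..N}" using cJ by (auto simp: k_def)
  define C where "C = {1..N} - J - {i}"
  have "card C = N - card J - 1"
  proof -
    have "card C = card ({1..N} - {i} - J)" unfolding C_def by (rule arg_cong[where f = card]) auto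
    also have "\<dots> = card ({1..N} - {i}) - card J" by (rule card_Diff_subset[OF fin J])
    finally show ?thesis using i by simp
  qed
  then have "card {1..<k} = card C" by (simp add: k_def)
  then obtain g where g: "bij_betw g {1..<k} C"
    using finite_same_card_bij[of "{1..<k}" C] by (auto simp: C_def)
  have "card {k<..N} = card J" using cJ by (simp add: k_def)
  then obtain f where f: "bij_betw f {k<..N} J"
    using finite_same_card_bij[of "{k<..N}" J] fin by auto
  define w where "w x = (if x = k then i else if x \<in> {k<..N} then f x else if x \<in> {1..<k} then g x else x)" for x
  have 1: "bij_betw w {1..<k} C" using g by (rule bij_betw_cong[THEN iffD1, rotated]) (auto simp: w_def)
  have 2: "bij_betw w {k} {i}" by (simp add: w_def bij_betw_def)
  have 3: "bij_betw w {k<..N} J" using f by (rule bij_betw_cong[THEN iffD1, rotated]) (auto simp: w_def)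
  have "bij_betw w ({1..<k} \<union> {k} \<union> {k<..N}) (C \<union> {i} \<union> J)"
    using J by (intro bij_betw_combine 1 2 3) (auto simp: C_def)
  moreover have "{1..<k} \<union> {k} \<union> {k<..N} = {1..N}" using k by auto
  moreover have "C \<union> {i} \<union> J = {1..N}" using i J by (auto simp: C_def)
  ultimately have "bij_betw w {1..N} {1..N}" by simp
  then have "w permutes {1..N}" by (rule bij_imp_permutes) (use k in \<open>auto simp: w_def\<close>)
  moreover have "w k = i" by (simp add: w_def)
  moreover have "w ` {k<..N} = J" using 3 by (simp add: bij_betw_def)
  ultimately show ?thesis using k by blast
qed

lemma transposition_sum_conj:
  fixes v :: "('a::field_char_0) vec"
  assumes P: "is_partition N \<tau>" and w: "w permutes {1..N}" and k: "k \<in> {1..N}" and v: "v \<in> Vspace N \<tau>"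
  shows "(\<Sum>j\<in>w ` {k<..N}. rep_perm N \<tau> (tr (w k) j) v S) =
    rep_perm N \<tau> w (\<lambda>S. of_int (content \<tau> S k) * rep_perm N \<tau> (inv w) v S) S"
proof -
  note iw = permutes_inv[OF w]
  have u: "rep_perm N \<tau> (inv w) v \<in> Vspace N \<tau>" by (rule rep_perm_Vspace[OF P iw v])
  have conj: "rep_perm N \<tau> (tr (w k) (w j)) v = rep_perm N \<tau> w (rep_perm N \<tau> (tr k j) (rep_perm N \<tau> (inv w) v))"
    if "j \<in> {k<..N}" for j
  proof -
    have t: "tr k j permutes {1..N}" using that k by (intro tr_permutes) auto
    show ?thesis
      unfolding conj_tr[OF w, symmetric] comp_assoc
      by (simp add: rep_perm_comp[OF P w permutes_compose[OF iw t] v] rep_perm_comp[OF P t iw v])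
  qed
  have "(\<Sum>j\<in>w ` {k<..N}. rep_perm N \<tau> (tr (w k) j) v S) = (\<Sum>j\<in>{k<..N}. rep_perm N \<tau> (tr (w k) (w j)) v S)"
    using permutes_inj_on[OF w] by (subst sum.reindex) auto
  also have "\<dots> = rep_perm N \<tau> w (jucys_murphy N \<tau> k (rep_perm N \<tau> (inv w) v)) S"
    unfolding jucys_murphy_def rep_perm_sum by (simp add: conj)
  also have "jucys_murphy N \<tau> k (rep_perm N \<tau> (inv w) v) = (\<lambda>S. of_int (content \<tau> S k) * rep_perm N \<tau> (inv w) v S)"
    using k by (intro ext jucys_murphy_diagonal[OF P _ _ u]) auto
  finally show ?thesis .
qed

section \<open>Moving the last row to the end of the first row\<close>

lemma sum_list_take_Suc: "k < length xs \<Longrightarrow> sum_list (take (Suc k) xs) = sum_list (take k xs) + (xs ! k :: nat)"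
  by (simp add: take_Suc_conv_app_nth)

lemma sum_list_take_mono: "k \<le> n \<Longrightarrow> sum_list (take k xs) \<le> sum_list (take n (xs :: nat list))"
proof -
  assume "k \<le> n"
  then have "take n xs = take k xs @ take (n - k) (drop k xs)"
    by (metis le_add_diff_inverse take_add)
  then show ?thesis by simp
qed

lemma reading_position_exists:
  "1 \<le> p \<Longrightarrow> p \<le> sum_list \<tau> \<Longrightarrow> \<exists>i j. (i,j) \<in> cells \<tau> \<and> sum_list (take (i - 1) \<tau>) + j = p"
proof (induction \<tau> rule: rev_induct)
  case (snoc x xs)
  show ?case
  proof (cases "p \<le> sum_list xs")
    case True
    with snoc obtain i j where ij: "(i,j) \<in> cells xs" "sum_list (take (i - 1) xs) + j = p" by blast
    then have "(i,j) \<in> cells (xs @ [x])" by (auto simp: cells_def nth_append)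
    moreover have "take (i - 1) (xs @ [x]) = take (i - 1) xs" using ij by (auto simp: cells_def)
    ultimately show ?thesis using ij by (intro exI[of _ i] exI[of _ j]) simp
  next
    case False
    with snoc.prems show ?thesis
      by (intro exI[of _ "Suc (length xs)"] exI[of _ "p - sum_list xs"]) (auto simp: cells_def)
  qed
qed simp

lemma T1_RSYT:
  assumes P: "is_partition N \<tau>" shows "T1 \<tau> \<in> RSYT N \<tau>"
proof -
  \<comment> \<open>\<open>s i\<close> counts the cells above row \<open>i\<close>, so
    \<open>s i + j\<close> is the position of \<open>(i,j)\<close> in row reading, and
    \<open>T1\<close> is \<open>Suc N\<close> minus this position.\<close>
  define s where "s i = sum_list (take (i - 1) \<tau>)" for i
  have N: "sum_list \<tau> = N" using P by (simp add: is_partition_def)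
  have bound: "s i + j \<le> s (Suc i)" "s (Suc i) \<le> N" if "(i,j) \<in> cells \<tau>" for i j
  proof -
    have "s (Suc i) = s i + \<tau> ! (i - 1)"
      using that sum_list_take_Suc[of "i - 1" \<tau>] by (cases i) (auto simp: s_def cells_def)
    then show "s i + j \<le> s (Suc i)" using that by (simp add: cells_def)
    show "s (Suc i) \<le> N" using sum_list_take_mono[of i "max i (length \<tau>)" \<tau>] N by (simp add: s_def)
  qed
  have T1: "T1 \<tau> (i,j) = Suc N - (s i + j)" if "(i,j) \<in> cells \<tau>" for i j
    using that cells_pos[OF that] by (simp add: T1_def s_def N)
  have less: "s i + j < s i' + j'" if "(i,j) \<in> cells \<tau>" "(i',j') \<in> cells \<tau>" "i < i' \<or> i = i' \<and> j < j'" for i j i' j'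
  proof (cases "i < i'")
    case True
    then have "s (Suc i) \<le> s i'" unfolding s_def by (intro sum_list_take_mono) simp
    with bound(1)[OF that(1)] cells_pos[OF that(2)] show ?thesis by simp
  qed (use that in auto)
  have inj: "inj_on (T1 \<tau>) (cells \<tau>)"
  proof (rule inj_onI, clarify)
    fix i j i' j' assume c: "(i,j) \<in> cells \<tau>" "(i',j') \<in> cells \<tau>" "T1 \<tau> (i,j) = T1 \<tau> (i',j')"
    then have "s i + j = s i' + j'" using T1 bound[OF c(1)] bound[OF c(2)] by fastforce
    with less[OF c(1,2)] less[OF c(2,1)] show "i = i' \<and> j = j'" by force
  qed
  have "T1 \<tau> ` cells \<tau> = {1..N}"
  proof (intro equalityI subsetI)
    fix k assume "k \<in> T1 \<tau> ` cells \<tau>"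
    then obtain i j where c: "(i,j) \<in> cells \<tau>" "k = T1 \<tau> (i,j)" by auto
    with bound[OF c(1)] cells_pos[OF c(1)] show "k \<in> {1..N}" by (auto simp: T1)
  next
    fix k assume k: "k \<in> {1..N}"
    then obtain i j where "(i,j) \<in> cells \<tau>" "s i + j = Suc N - k"
      using reading_position_exists[of "Suc N - k" \<tau>] N unfolding s_def by fastforce
    with k T1 show "k \<in> T1 \<tau> ` cells \<tau>" by (intro image_eqI[of _ _ "(i,j)"]) auto
  qed
  moreover have "T1 \<tau> (i,Suc j) < T1 \<tau> (i,j)" if "(i,j) \<in> cells \<tau>" "(i,Suc j) \<in> cells \<tau>" for i j
    using that bound[OF that(2)] by (simp add: T1)
  moreover have "T1 \<tau> (Suc i,j) < T1 \<tau> (i,j)" if c: "(i,j) \<in> cells \<tau>" "(Suc i,j) \<in> cells \<tau>" for i j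
    unfolding T1[OF c(1)] T1[OF c(2)] using bound[OF c(2)] bound[OF c(1)] cells_pos[OF c(1)] by linarith
  ultimately show ?thesis
    using inj by (auto simp: RSYT_def bij_betw_def) (auto simp: T1_def)
qed

text \<open>The pattern \<open>a # mid @ [m]\<close> builds in that there are at least two rows.
  \<open>mid\<close> may be empty, in which case \<open>\<sigma>\<close> is a single row.\<close>

locale bottom_row_move =
  fixes N :: nat and a :: nat and mid :: "nat list" and m :: nat and \<tau> \<sigma> :: "nat list"
  assumes P: "is_partition N \<tau>"
    and tau: "\<tau> = a # mid @ [m]" and sigma: "\<sigma> = (a + m) # mid"
begin

lemma m_pos: "1 \<le> m"
  using P by (auto simp: is_partition_def tau)

lemma m_le_a: "m \<le> a"
  using P by (auto simp: is_partition_def tau)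

lemma m_less_N: "m < N"
  using P by (auto simp: is_partition_def tau)

lemma sigma_partition: "is_partition N \<sigma>"
  using P by (auto simp: is_partition_def tau sigma sorted_wrt_append)

abbreviation "l \<equiv> length \<tau>"
abbreviation "A \<equiv> cells (a # mid)"
abbreviation "L \<equiv> {l} \<times> {1..m}"
abbreviation "L' \<equiv> {1} \<times> {a<..a + m}"

lemma l_eq: "l = Suc (Suc (length mid))"
  by (simp add: tau)

lemma cells_tau: "cells \<tau> = A \<union> L"
  by (auto simp: cells_def tau nth_append nth_Cons' split: if_splits)

lemma cells_sigma: "cells \<sigma> = A \<union> L'"
  by (auto simp: cells_def sigma nth_Cons' split: if_splits)

lemma A_bound: "(r,c) \<in> A \<Longrightarrow> 1 \<le> r \<and> r < l"
  by (auto simp: cells_def tau)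

lemma A_L: "A \<inter> L = {}"
  using A_bound by auto

lemma A_L': "A \<inter> L' = {}"
  by (auto simp: cells_def)

lemma A_down: "(r',c') \<in> A \<Longrightarrow> 1 \<le> r \<Longrightarrow> r \<le> r' \<Longrightarrow> 1 \<le> c \<Longrightarrow> c \<le> c' \<Longrightarrow> (r,c) \<in> A"
  using cells_down[OF P, of r' c' r c] A_bound[of r' c'] by (auto simp: cells_tau)

definition Y0 :: "tab set" where
  "Y0 = {S \<in> RSYT N \<tau>. \<forall>c\<in>{1..m}. S (l,c) = Suc m - c}"

text \<open>On \<open>L'\<close> the value \<open>Suc (a + m) - snd c\<close> is the entry that a
  tableau in \<open>Y0\<close> has in column \<open>snd c - a\<close> of its last row: the row moves
  together with its entries.\<close>

definition up :: "tab \<Rightarrow> tab" where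
  "up S = (\<lambda>c. if c \<in> A then S c else if c \<in> L' then Suc (a + m) - snd c else 0)"

lemma Y0_bottom:
  assumes "S \<in> Y0" "1 \<le> k" "k \<le> m"
  shows "S (l, Suc m - k) = k"
proof -
  have "Suc m - k \<in> {1..m}" using assms by auto
  with assms(1) have "S (l, Suc m - k) = Suc m - (Suc m - k)" unfolding Y0_def by blast
  with assms show ?thesis by simp
qed

lemma Y0_bij:
  assumes S: "S \<in> Y0" shows "bij_betw S A {m<..N}"
proof -
  have b: "bij_betw S (A \<union> L) {1..N}"
    using S RSYT_bij[of S N \<tau>] by (simp add: Y0_def cells_tau)
  have "S ` L = {1..m}"
  proof (intro equalityI subsetI)
    fix k assume k: "k \<in> {1..m}"
    then have "S (l, Suc m - k) = k" using Y0_bottom[OF S] by simp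
    with k show "k \<in> S ` L" by (intro image_eqI[of _ _ "(l, Suc m - k)"]) auto
  qed (use S in \<open>auto simp: Y0_def\<close>)
  moreover have "S ` ((A \<union> L) - L) = S ` (A \<union> L) - S ` L"
    using b by (intro inj_on_image_set_diff[of _ "A \<union> L"]) (auto simp: bij_betw_def)
  moreover have "(A \<union> L) - L = A" using A_L by blast
  ultimately have "S ` A = {1..N} - {1..m}" using b by (simp add: bij_betw_def)
  moreover have "{1..N} - {1..m} = {m<..N}" by auto
  ultimately show ?thesis using b by (auto simp: bij_betw_def inj_on_Un)
qed

text \<open>The moved entries are the smallest ones, so they may end the first row; nothing lies
  below them, because no row of \<open>mid\<close> is longer than \<open>a\<close>.\<close>

lemma up_RSYT:
  assumes S: "S \<in> Y0" shows "up S \<in> RSYT N \<sigma>"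
proof -
  have T: "S \<in> RSYT N \<tau>" using S by (simp add: Y0_def)
  have 1: "bij_betw (up S) A {m<..N}"
    using Y0_bij[OF S] by (rule bij_betw_cong[THEN iffD1, rotated]) (simp add: up_def)
  have "bij_betw (\<lambda>c. Suc (a + m) - snd c) L' {1..m}"
    by (rule bij_betw_byWitness[where f' = "\<lambda>k. (1, Suc (a + m) - k)"]) auto
  then have 2: "bij_betw (up S) L' {1..m}"
    by (rule bij_betw_cong[THEN iffD1, rotated]) (use A_L' in \<open>auto simp: up_def\<close>)
  have "bij_betw (up S) (A \<union> L') ({m<..N} \<union> {1..m})"
    by (rule bij_betw_combine[OF 1 2]) auto
  moreover have "{m<..N} \<union> {1..m} = {1..N}" using m_less_N by auto
  ultimately have bij: "bij_betw (up S) (cells \<sigma>) {1..N}" by (simp add: cells_sigma)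
  have gt: "m < S c" if "c \<in> A" for c
    using Y0_bij[OF S] that by (auto simp: bij_betw_def)
  have row: "up S (i,Suc j) < up S (i,j)" if c: "(i,j) \<in> cells \<sigma>" "(i,Suc j) \<in> cells \<sigma>" for i j
  proof (cases "(i,Suc j) \<in> A")
    case True
    then have "(i,j) \<in> A" using cells_pos[OF c(1)] by (intro A_down[OF True]) auto
    with True RSYT_row[OF T] show ?thesis by (simp add: up_def cells_tau)
  next
    case False
    with c have L: "(i,Suc j) \<in> L'" by (auto simp: cells_sigma)
    show ?thesis
    proof (cases "(i,j) \<in> A")
      case True
      with gt[OF True] L False show ?thesis by (auto simp: up_def)
    next
      case f: False
      with c have "(i,j) \<in> L'" by (auto simp: cells_sigma)
      with L f False show ?thesis by (auto simp: up_def)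
    qed
  qed
  have col: "up S (Suc i,j) < up S (i,j)" if c: "(i,j) \<in> cells \<sigma>" "(Suc i,j) \<in> cells \<sigma>" for i j
  proof -
    have "(Suc i,j) \<in> A" using c cells_pos[OF c(1)] by (auto simp: cells_sigma)
    moreover have "(i,j) \<in> A" using cells_pos[OF c(1)] by (intro A_down[OF calculation]) auto
    ultimately show ?thesis using RSYT_col[OF T] by (simp add: up_def cells_tau)
  qed
  have "up S c = 0" if "c \<notin> cells \<sigma>" for c
    using that by (auto simp: up_def cells_sigma)
  with bij row col show ?thesis by (auto simp: RSYT_def)
qed

lemma up_inj: "S \<in> Y0 \<Longrightarrow> T \<in> Y0 \<Longrightarrow> up S = up T \<Longrightarrow> S = T"
proof
  fix c assume S: "S \<in> Y0" "T \<in> Y0" "up S = up T"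
  consider "c \<in> A" | "c \<in> L" | "c \<notin> cells \<tau>" by (auto simp: cells_tau)
  then show "S c = T c"
  proof cases
    case 1
    with fun_cong[OF S(3), of c] show ?thesis by (simp add: up_def)
  next
    case 2
    with S show ?thesis by (auto simp: Y0_def)
  next
    case 3
    with S RSYT_outside[of S N \<tau> c] RSYT_outside[of T N \<tau> c] show ?thesis by (simp add: Y0_def)
  qed
qed

lemma entry_cell_high:
  assumes S: "S \<in> Y0" and k: "m < k" "k \<le> N"
  shows "entry_cell \<sigma> (up S) k = entry_cell \<tau> S k"
proof -
  have "k \<in> S ` A" using Y0_bij[OF S] k by (simp add: bij_betw_def)
  then obtain c where c: "c \<in> A" "S c = k" by blast
  then have "up S c = k" by (simp add: up_def)
  then have "entry_cell \<sigma> (up S) k = c" using c by (intro entry_cell_eqI[OF up_RSYT[OF S]]) (auto simp: cells_sigma)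
  moreover have "entry_cell \<tau> S k = c" using c S by (intro entry_cell_eqI[of S N]) (auto simp: cells_tau Y0_def)
  ultimately show ?thesis by simp
qed

lemma entry_cell_low:
  assumes S: "S \<in> Y0" and k: "1 \<le> k" "k \<le> m"
  shows "entry_cell \<tau> S k = (l, Suc m - k)" "entry_cell \<sigma> (up S) k = (1, Suc (a + m) - k)"
proof -
  show "entry_cell \<tau> S k = (l, Suc m - k)"
    using S k Y0_bottom[OF S k] by (intro entry_cell_eqI[of S N]) (auto simp: cells_tau Y0_def)
  have "(1, Suc (a + m) - k) \<in> L'" using k by auto
  moreover from this have "(1, Suc (a + m) - k) \<notin> A" using A_L' by blast
  ultimately show "entry_cell \<sigma> (up S) k = (1, Suc (a + m) - k)"
    using k by (intro entry_cell_eqI[OF up_RSYT[OF S]]) (auto simp: cells_sigma up_def)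
qed

text \<open>The shift is that of a cell going from row \<open>l\<close> to row 1 and
  \<open>a\<close> columns to the right. By \<open>h_tau_eq\<close> it is the hook length of the
  corner, and this is where 1/h_tau originates.\<close>

lemma content_up:
  assumes S: "S \<in> Y0" and k: "1 \<le> k" "k \<le> N"
  shows "content \<sigma> (up S) k = content \<tau> S k + (if k \<le> m then int (a + l) - 1 else 0)"
  using k entry_cell_low[OF S k(1)] entry_cell_high[OF S _ k(2)]
  by (auto simp: content_def of_nat_diff)

text \<open>Unless \<open>i = m\<close>, the contents of \<open>i\<close> and \<open>Suc i\<close>
  shift together or not at all. Thus the generators other than s_m have the same seminormal
  coefficients in both representations.\<close>

lemma axial_up:
  assumes S: "S \<in> Y0" and i: "1 \<le> i" "i < N" "i \<noteq> m"
  shows "axial \<sigma> (up S) i = axial \<tau> S i"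
proof -
  have "content \<sigma> (up S) (Suc i) = content \<tau> S (Suc i) + (if Suc i \<le> m then int (a + l) - 1 else 0)"
    using i by (intro content_up[OF S]) auto
  moreover have "content \<sigma> (up S) i = content \<tau> S i + (if i \<le> m then int (a + l) - 1 else 0)"
    using i by (intro content_up[OF S]) auto
  moreover have "i \<le> m \<longleftrightarrow> Suc i \<le> m" using i by auto
  ultimately show ?thesis by (simp only: axial_def)
qed

lemma axial_low:
  assumes S: "S \<in> Y0" and i: "1 \<le> i" "i < m"
  shows "axial \<tau> S i = 1"
  using entry_cell_low(1)[OF S, of i] entry_cell_low(1)[OF S, of "Suc i"] i
  by (auto simp: axial_def content_def of_nat_diff)

lemma tswap_Y0:
  assumes S: "S \<in> Y0" and i: "m < i" and T: "tswap i S \<in> RSYT N \<tau>"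
  shows "tswap i S \<in> Y0"
proof -
  have "tswap i S (l,c) = Suc m - c" if "c \<in> {1..m}" for c
  proof -
    have "S (l,c) = Suc m - c" using S that by (simp add: Y0_def)
    moreover have "Suc m - c < i" using i that by auto
    ultimately show ?thesis by (simp add: tswap_def)
  qed
  with T show ?thesis by (simp add: Y0_def)
qed

lemma tswap_up:
  assumes i: "m < i"
  shows "tswap i (up S) = up (tswap i S)"
proof
  fix c
  show "tswap i (up S) c = up (tswap i S) c"
  proof (cases "c \<in> A")
    case False
    then have "up S c \<le> m" by (auto simp: up_def)
    with i False show ?thesis by (simp add: up_def tswap_def)
  qed (simp add: up_def tswap_def)
qed

text \<open>In terms of basis vectors: \<open>up S\<close> goes to \<open>S\<close> for
  \<open>S\<close> in \<open>Y0\<close>, and every other tableau of shape \<open>\<sigma>\<close>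
  goes to 0.\<close>

definition pull :: "('b::field) vec \<Rightarrow> 'b vec" where
  "pull v = (\<lambda>S. if S \<in> Y0 then v (up S) else 0)"

lemma pull_Vspace: "pull v \<in> Vspace N \<tau>"
  by (auto simp: pull_def Vspace_def Y0_def)

lemma pull_lincomb: "pull (\<lambda>S. \<Sum>j\<in>J. c j * f j S) = (\<lambda>S. \<Sum>j\<in>J. c j * pull (f j) S)"
  by (auto simp: pull_def)

text \<open>No swap with \<open>i \<noteq> m\<close> enters or leaves \<open>Y0\<close> with a
  nonzero coefficient: for \<open>i > m\<close> the last row is not touched, and for
  \<open>i < m\<close> the entries \<open>i\<close> and \<open>Suc i\<close> are neighbours in the
  last row, where \<open>offdiag\<close> vanishes.\<close>

lemma pull_repS:
  assumes i: "1 \<le> i" "i < N" "i \<noteq> m" and v: "v \<in> Vspace N \<sigma>"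
  shows "pull (repS N \<sigma> i v) = repS N \<tau> i (pull v)"
proof (rule Vspace_eqI[OF pull_Vspace repS_Vspace[OF P i(1,2)]])
  fix S assume S: "S \<in> RSYT N \<tau>"
  have R: "repS N \<tau> i (pull v) S = pull v S / of_int (axial \<tau> S i) + offdiag (- axial \<tau> S i) * pull v (tswap i S)"
    using repS_eval[OF P S i(1,2) pull_Vspace, of v] by (simp add: young_op_def)
  show "pull (repS N \<sigma> i v) S = repS N \<tau> i (pull v) S"
  proof (cases "S \<in> Y0")
    case True
    have "offdiag (- axial \<tau> S i) * v (tswap i (up S)) = offdiag (- axial \<tau> S i) * pull v (tswap i S)"
    proof (cases "i < m")
      case False
      with i have im: "m < i" by simp
      show ?thesis
      proof (cases "offdiag (- axial \<tau> S i) = (0::'a)")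
        case False
        then have "tswap i S \<in> RSYT N \<tau>" by (intro tswap_RSYT[OF P S i(1,2)]) (auto dest!: offdiag_nonzero)
        then show ?thesis using tswap_Y0[OF True im] by (simp add: tswap_up[OF im] pull_def)
      qed simp
    qed (simp add: axial_low[OF True i(1)] offdiag_def)
    then show ?thesis
      unfolding R using repS_eval[OF sigma_partition up_RSYT[OF True] i(1,2) v] True
      by (simp add: young_op_def axial_up[OF True i] pull_def)
  next
    case False
    have "offdiag (- axial \<tau> S i) * pull v (tswap i S) = 0"
    proof (cases "tswap i S \<in> Y0")
      case True
      \<comment> \<open>Otherwise \<open>i > m\<close>, and swapping back would put \<open>S\<close>
        into \<open>Y0\<close>.\<close>
      have "i < m"
        using tswap_Y0[OF True, of i] S False i by force
      then have "axial \<tau> S i = -1" using axial_low[OF True i(1)] by simp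
      then show ?thesis by (simp add: offdiag_def)
    qed (simp add: pull_def)
    then show ?thesis unfolding R using False by (simp add: pull_def)
  qed
qed

section \<open>The stabiliser of alpha and the induced family\<close>

lemma alpha_eq: "alpha \<tau> k = (if 1 \<le> k \<and> k \<le> m then 1 else 0)"
  by (simp add: alpha_def tau)

text \<open>A permutation fixing alpha preserves both {1..m} and {m+1..N}. It splits into one factor
  on each block, and neither factor needs the generator s_m.\<close>

lemma stabilizer_word:
  assumes w: "w permutes {1..N}" and st: "alpha \<tau> \<circ> w = alpha \<tau>"
  shows "\<exists>ws. set ws \<subseteq> {1..<N} - {m} \<and> word_perm ws = w"
proof -
  have st': "w k \<in> {1..m} \<longleftrightarrow> k \<in> {1..m}" for k
  proof -
    have "alpha \<tau> (w k) = alpha \<tau> k" using fun_cong[OF st, of k] by simp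
    then show ?thesis unfolding alpha_eq by (metis atLeastAtMost_iff zero_neq_one)
  qed
  have N': "w k \<in> {1..N} \<longleftrightarrow> k \<in> {1..N}" for k using permutes_in_image[OF w] .
  define w1 where "w1 k = (if k \<in> {1..m} then w k else k)" for k
  define w2 where "w2 k = (if k \<in> {Suc m..N} then w k else k)" for k
  have inj: "inj w" by (rule permutes_inj[OF w])
  have "w1 permutes {1..m}"
  proof (rule bij_imp_permutes)
    have "inj_on w1 {1..m}" "w1 ` {1..m} \<subseteq> {1..m}"
      using inj st' by (auto simp: w1_def inj_on_def) 
    then show "bij_betw w1 {1..m} {1..m}" by (simp add: bij_betw_def endo_inj_surj)
  qed (auto simp: w1_def)
  moreover have "w2 permutes {Suc m..N}"
  proof (rule bij_imp_permutes)
    have "w k \<in> {Suc m..N}" if "k \<in> {Suc m..N}" for k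
      using st'[of k] N'[of k] that by auto
    then have "inj_on w2 {Suc m..N}" "w2 ` {Suc m..N} \<subseteq> {Suc m..N}"
      using inj by (auto simp: w2_def inj_on_def)
    then show "bij_betw w2 {Suc m..N} {Suc m..N}" by (simp add: bij_betw_def endo_inj_surj)
  qed (auto simp: w2_def)
  ultimately obtain us ws where u: "set us \<subseteq> {1..<m}" "word_perm us = w1" "set ws \<subseteq> {Suc m..<N}" "word_perm ws = w2"
    using word_exists by metis
  have "w1 (w2 k) = w k" for k
  proof (cases "k \<in> {Suc m..N}")
    case True
    then have "w k \<notin> {1..m}" using st'[of k] by simp
    with True show ?thesis unfolding w1_def w2_def by presburger
  next
    case False
    with w show ?thesis using m_less_N by (auto simp: w1_def w2_def permutes_def)
  qed
  then have "word_perm (us @ ws) = w" using u by (auto simp: word_perm_append)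
  then show ?thesis using u m_less_N by (intro exI[of _ "us @ ws"]) auto
qed

lemma pull_rep_perm:
  fixes v :: "('b::field_char_0) vec"
  assumes w: "w permutes {1..N}" and st: "alpha \<tau> \<circ> w = alpha \<tau>" and v: "v \<in> Vspace N \<sigma>"
  shows "pull (rep_perm N \<sigma> w v) = rep_perm N \<tau> w (pull v)"
proof -
  obtain ws where ws: "set ws \<subseteq> {1..<N} - {m}" "word_perm ws = w" using stabilizer_word[OF w st] by blast
  have "pull (rep_word N \<sigma> ws v) = rep_word N \<tau> ws (pull v)"
    using ws(1)
  proof (induction ws)
    case (Cons i ws)
    have "rep_word N \<sigma> ws v \<in> Vspace N \<sigma>"
      using Cons.prems v by (intro rep_word_Vspace[OF sigma_partition]) auto
    then have "pull (repS N \<sigma> i (rep_word N \<sigma> ws v)) = repS N \<tau> i (pull (rep_word N \<sigma> ws v))"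
      using Cons.prems by (intro pull_repS) auto
    with Cons show ?case by (simp add: rep_word_def)
  qed (simp add: rep_word_def)
  moreover have "set ws \<subseteq> {1..<N}" using ws by auto
  ultimately show ?thesis
    using rep_perm_word[OF sigma_partition _ ws(2) v] rep_perm_word[OF P _ ws(2) pull_Vspace] by metis
qed

definition coset :: "(nat \<Rightarrow> nat) \<Rightarrow> (nat \<Rightarrow> nat) set" where
  "coset \<beta> = {w. w permutes {1..N} \<and> alpha \<tau> \<circ> inv w = \<beta>}"

text \<open>Summing over the whole coset avoids choosing a representative. By
  \<open>pull_rep_perm\<close> all summands coincide when \<open>v\<close> lies in
  \<open>Vspace N \<sigma>\<close>, so the family differs from that of a chosen representative by
  the order of the stabiliser.\<close>

definition induced :: "('b::field_char_0) vec \<Rightarrow> 'b ptau" where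
  "induced v \<beta> = (\<lambda>S. \<Sum>w\<in>coset \<beta>. rep_perm N \<tau> w (pull (rep_perm N \<sigma> (inv w) v)) S)"

lemma finite_coset: "finite (coset \<beta>)"
  by (rule finite_subset[OF _ finite_permutations[of "{1..N}"]]) (auto simp: coset_def)

lemma induced_Vspace: "induced v \<beta> \<in> Vspace N \<tau>"
proof -
  have "rep_perm N \<tau> w (pull (rep_perm N \<sigma> (inv w) v)) \<in> Vspace N \<tau>" if "w \<in> coset \<beta>" for w
    using that by (intro rep_perm_Vspace[OF P _ pull_Vspace]) (auto simp: coset_def)
  then show ?thesis by (auto simp: Vspace_def induced_def)
qed

lemma induced_lincomb:
  "induced (\<lambda>S. \<Sum>j\<in>J. c j * f j S) \<beta> = (\<lambda>S. \<Sum>j\<in>J. c j * induced (f j) \<beta> S)"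
proof
  fix S
  have "induced (\<lambda>S. \<Sum>j\<in>J. c j * f j S) \<beta> S = 
    (\<Sum>w\<in>coset \<beta>. \<Sum>j\<in>J. c j * rep_perm N \<tau> w (pull (rep_perm N \<sigma> (inv w) (f j))) S)"
    by (simp add: induced_def rep_perm_lincomb pull_lincomb)
  also have "\<dots> = (\<Sum>j\<in>J. c j * induced (f j) \<beta> S)"
    by (subst sum.swap) (simp add: induced_def sum_distrib_left)
  finally show "induced (\<lambda>S. \<Sum>j\<in>J. c j * f j S) \<beta> S = (\<Sum>j\<in>J. c j * induced (f j) \<beta> S)" .
qed

text \<open>The left side is the coefficient at \<open>\<beta>\<close> of g applied to the family in
  P_tau. Left translation by \<open>g\<close> carries \<open>coset (\<beta> \<circ> g)\<close> onto
  \<open>coset \<beta>\<close>.\<close>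

lemma induced_equivariant:
  assumes g: "g permutes {1..N}" and v: "v \<in> Vspace N \<sigma>"
  shows "rep_perm N \<tau> g (induced v (\<beta> \<circ> g)) = induced (rep_perm N \<sigma> g v) \<beta>"
proof
  fix S
  have "rep_perm N \<tau> g (induced v (\<beta> \<circ> g)) S =
    (\<Sum>w\<in>coset (\<beta> \<circ> g). rep_perm N \<tau> g (rep_perm N \<tau> w (pull (rep_perm N \<sigma> (inv w) v))) S)"
    by (simp add: induced_def rep_perm_sum)
  also have "\<dots> = (\<Sum>u\<in>coset \<beta>. rep_perm N \<tau> u (pull (rep_perm N \<sigma> (inv u) (rep_perm N \<sigma> g v))) S)"
  proof (rule sum.reindex_bij_witness[of _ "\<lambda>u. inv g \<circ> u" "\<lambda>w. g \<circ> w"])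
    fix w assume "w \<in> coset (\<beta> \<circ> g)"
    then have w: "w permutes {1..N}" and e: "alpha \<tau> \<circ> inv w = \<beta> \<circ> g" by (auto simp: coset_def)
    have i: "inv (g \<circ> w) = inv w \<circ> inv g"
      using permutes_bij[OF g] permutes_bij[OF w] by (simp add: o_inv_distrib)
    show "inv g \<circ> (g \<circ> w) = w" unfolding comp_assoc[symmetric] permutes_inv_o[OF g] by simp
    have "alpha \<tau> \<circ> inv (g \<circ> w) = (\<beta> \<circ> g) \<circ> inv g" unfolding i comp_assoc[symmetric] e ..
    also have "\<dots> = \<beta>" by (simp add: comp_assoc permutes_inv_o[OF g])
    finally show "g \<circ> w \<in> coset \<beta>" using permutes_compose[OF w g] by (simp add: coset_def)
    have "rep_perm N \<sigma> (inv (g \<circ> w)) (rep_perm N \<sigma> g v) = rep_perm N \<sigma> (inv w) v"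
      unfolding i rep_perm_comp[OF sigma_partition permutes_inv[OF w] permutes_inv[OF g] rep_perm_Vspace[OF sigma_partition g v]]
        rep_perm_inverse(2)[OF sigma_partition g v] ..
    then show "rep_perm N \<tau> (g \<circ> w) (pull (rep_perm N \<sigma> (inv (g \<circ> w)) (rep_perm N \<sigma> g v))) S =
      rep_perm N \<tau> g (rep_perm N \<tau> w (pull (rep_perm N \<sigma> (inv w) v))) S"
      using rep_perm_comp[OF P g w pull_Vspace, of "rep_perm N \<sigma> (inv w) v"] by simp
  next
    fix u assume "u \<in> coset \<beta>"
    then have u: "u permutes {1..N}" and e: "alpha \<tau> \<circ> inv u = \<beta>" by (auto simp: coset_def)
    show "g \<circ> (inv g \<circ> u) = u" unfolding comp_assoc[symmetric] permutes_inv_o[OF g] by simp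
    have "inv (inv g \<circ> u) = inv u \<circ> g"
      using permutes_bij[OF permutes_inv[OF g]] permutes_bij[OF u] by (simp add: o_inv_distrib permutes_inv_inv[OF g])
    then have "alpha \<tau> \<circ> inv (inv g \<circ> u) = \<beta> \<circ> g" using e by (simp add: comp_assoc[symmetric])
    then show "inv g \<circ> u \<in> coset (\<beta> \<circ> g)" using permutes_compose[OF u permutes_inv[OF g]] by (simp add: coset_def)
  qed
  finally show "rep_perm N \<tau> g (induced v (\<beta> \<circ> g)) S = induced (rep_perm N \<sigma> g v) \<beta> S"
    by (simp add: induced_def)
qed

lemma T1_Y0: "T1 \<tau> \<in> Y0"
proof -
  have "T1 \<tau> (l,c) = Suc m - c" if "c \<in> {1..m}" for c
  proof -
    have "(l,c) \<in> cells \<tau>" using that by (simp add: cells_tau)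
    then show ?thesis using that by (simp add: T1_def tau) 
  qed
  with T1_RSYT[OF P] show ?thesis by (simp add: Y0_def)
qed

text \<open>The denominator is the order of the stabiliser of alpha; it normalises the coefficient
  at alpha to T_1, the leading term of zeta.\<close>

definition singular_vector :: "real ptau" where
  "singular_vector \<beta> = (\<lambda>S. induced (bvec (up (T1 \<tau>))) \<beta> S / real (card (coset (alpha \<tau>))))"

lemma bvec_Vspace: "T \<in> RSYT N \<tau>' \<Longrightarrow> bvec T \<in> Vspace N \<tau>'"
  by (auto simp: bvec_def Vspace_def)

lemma pull_bvec: "pull (bvec (up (T1 \<tau>))) = bvec (T1 \<tau>)"
proof
  fix S
  show "pull (bvec (up (T1 \<tau>))) S = bvec (T1 \<tau>) S"
    using T1_Y0 up_inj[of S "T1 \<tau>"] by (cases "S = T1 \<tau>") (auto simp: pull_def bvec_def)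
qed

lemma singular_vector_Vspace: "singular_vector \<beta> \<in> Vspace N \<tau>"
  using induced_Vspace[of "bvec (up (T1 \<tau>))" \<beta>] by (auto simp: singular_vector_def Vspace_def)

lemma singular_vector_support:
  assumes "singular_vector \<beta> S \<noteq> 0"
  obtains w where "w permutes {1..N}" "\<beta> = alpha \<tau> \<circ> w"
proof -
  have "coset \<beta> \<noteq> {}" using assms by (auto simp: singular_vector_def induced_def)
  then obtain w where "w permutes {1..N}" "alpha \<tau> \<circ> inv w = \<beta>" by (auto simp: coset_def)
  then show thesis using that[of "inv w"] permutes_inv by auto
qed

lemma singular_vector_alpha: "singular_vector (alpha \<tau>) = bvec (T1 \<tau>)"
proof
  fix S
  let ?v = "bvec (up (T1 \<tau>)) :: real vec"
  have v: "?v \<in> Vspace N \<sigma>" by (rule bvec_Vspace[OF up_RSYT[OF T1_Y0]])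
  have "rep_perm N \<tau> w (pull (rep_perm N \<sigma> (inv w) ?v)) = bvec (T1 \<tau>)" if "w \<in> coset (alpha \<tau>)" for w
  proof -
    have w: "w permutes {1..N}" "alpha \<tau> \<circ> inv w = alpha \<tau>" using that by (auto simp: coset_def)
    have "rep_perm N \<tau> w (pull (rep_perm N \<sigma> (inv w) ?v)) = rep_perm N \<tau> w (rep_perm N \<tau> (inv w) (pull ?v))"
      by (simp only: pull_rep_perm[OF permutes_inv[OF w(1)] w(2) v])
    also have "\<dots> = pull ?v" by (rule rep_perm_inverse[OF P w(1) pull_Vspace])
    finally show ?thesis by (simp add: pull_bvec)
  qed
  moreover have "id \<in> coset (alpha \<tau>)" by (simp add: coset_def permutes_id)
  then have "card (coset (alpha \<tau>)) \<noteq> 0" using finite_coset by auto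
  ultimately show "singular_vector (alpha \<tau>) S = bvec (T1 \<tau>) S"
    by (simp add: singular_vector_def induced_def)
qed

lemma h_tau_eq: "h_tau \<tau> = a + l - 1"
proof -
  have "{k. Suc 0 < k \<and> k \<le> l \<and> Suc 0 \<le> \<tau> ! (k - Suc 0)} = {2..l}"
    using P by (auto simp: is_partition_def Suc_le_eq)
  then show ?thesis using m_pos m_le_a l_eq by (simp add: h_tau_def hook_length_def tau)
qed

text \<open>By equivariance the i-th Jucys-Murphy element of P_tau acts as that of V_sigma does on
  the basis vector \<open>up (T1 \<tau>)\<close>, that is, by its content in
  \<open>\<sigma>\<close>.\<close>

lemma singular_vector_jucys_murphy:
  assumes i: "i \<in> {1..N}"
  shows "(\<Sum>j\<in>{i<..N}. rep_perm N \<tau> (tr i j) (singular_vector (\<beta> \<circ> tr i j)) S) =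
    (of_int (content \<tau> (T1 \<tau>) i) + real (alpha \<tau> i) * real (h_tau \<tau>)) * singular_vector \<beta> S"
proof -
  let ?T = "up (T1 \<tau>)" let ?v = "bvec (up (T1 \<tau>)) :: real vec" let ?n = "real (card (coset (alpha \<tau>)))"
  have v: "?v \<in> Vspace N \<sigma>" by (rule bvec_Vspace[OF up_RSYT[OF T1_Y0]])
  have "rep_perm N \<tau> (tr i j) (singular_vector (\<beta> \<circ> tr i j)) S = induced (rep_perm N \<sigma> (tr i j) ?v) \<beta> S / ?n"
    if "j \<in> {i<..N}" for j
  proof -
    have "tr i j permutes {1..N}" using that i by (intro tr_permutes) auto
    then show ?thesis
      using induced_equivariant[OF _ v, of "tr i j" \<beta>]
        rep_perm_scale[of N \<tau> "tr i j" "1 / ?n" "induced ?v (\<beta> \<circ> tr i j)"]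
      by (simp add: singular_vector_def)
  qed
  then have "(\<Sum>j\<in>{i<..N}. rep_perm N \<tau> (tr i j) (singular_vector (\<beta> \<circ> tr i j)) S) =
    (\<Sum>j\<in>{i<..N}. induced (rep_perm N \<sigma> (tr i j) ?v) \<beta> S) / ?n"
    by (simp add: sum_divide_distrib)
  also have "(\<Sum>j\<in>{i<..N}. induced (rep_perm N \<sigma> (tr i j) ?v) \<beta> S) = induced (jucys_murphy N \<sigma> i ?v) \<beta> S"
    using induced_lincomb[of "\<lambda>_. 1" "\<lambda>j. rep_perm N \<sigma> (tr i j) ?v" "{i<..N}" \<beta>]
    by (simp add: jucys_murphy_def)
  also have "jucys_murphy N \<sigma> i ?v = (\<lambda>S. of_int (content \<sigma> ?T i) * ?v S)"
  proof
    fix S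
    show "jucys_murphy N \<sigma> i ?v S = of_int (content \<sigma> ?T i) * ?v S"
      using i jucys_murphy_diagonal[OF sigma_partition _ _ v, of i S] by (auto simp: bvec_def)
  qed
  also have "induced (\<lambda>S. of_int (content \<sigma> ?T i) * ?v S) \<beta> S = of_int (content \<sigma> ?T i) * induced ?v \<beta> S"
    using induced_lincomb[of "\<lambda>_. of_int (content \<sigma> ?T i)" "\<lambda>_. ?v" "{()}" \<beta>] by simp
  also have "real_of_int (content \<sigma> ?T i) = of_int (content \<tau> (T1 \<tau>) i) + real (alpha \<tau> i) * real (h_tau \<tau>)"
    using i m_pos m_le_a content_up[OF T1_Y0, of i] by (auto simp: alpha_eq h_tau_eq of_nat_diff)
  finally show ?thesis by (simp add: singular_vector_def comp_def)
qed

end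

section \<open>Dunkl operators on multilinear elements\<close>

text \<open>x_i - x_j is not a zero divisor: the equation at x_i x^\<beta> expresses the coefficient
  of \<open>g\<close> at \<open>\<beta>\<close> through one with smaller exponent at
  \<open>j\<close>. This is the uniqueness behind the description in \<open>ddiff\<close>.\<close>

lemma mulx_diff_inject:
  fixes g g' :: "('a::field) ptau"
  assumes ij: "i \<noteq> j"
    and eq: "\<And>\<beta> T. mulx i g \<beta> T - mulx j g \<beta> T = mulx i g' \<beta> T - mulx j g' \<beta> T"
  shows "g = g'"
proof -
  have "\<forall>\<beta>. \<beta> j = n \<longrightarrow> g \<beta> T = g' \<beta> T" for n T
  proof (induction n)
    case 0
    show ?case
    proof (intro allI impI)
      fix \<beta> :: "nat \<Rightarrow> nat" assume "\<beta> j = 0"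
      with eq[of "\<beta>(i := Suc (\<beta> i))" T] ij show "g \<beta> T = g' \<beta> T" by (simp add: mulx_def)
    qed
  next
    case (Suc n)
    show ?case
    proof (intro allI impI)
      fix \<beta> :: "nat \<Rightarrow> nat" assume b: "\<beta> j = Suc n"
      have "g (\<beta>(i := Suc (\<beta> i), j := n)) T = g' (\<beta>(i := Suc (\<beta> i), j := n)) T"
        using Suc.IH[rule_format, of "\<beta>(i := Suc (\<beta> i), j := n)"] by simp
      with eq[of "\<beta>(i := Suc (\<beta> i))" T] ij b show "g \<beta> T = g' \<beta> T" by (simp add: mulx_def)
    qed
  qed
  then show ?thesis by (simp add: fun_eq_iff)
qed

lemma ddiff_eqI:
  assumes "i \<noteq> j" "Ptau N \<tau> g"
    "\<And>\<beta> T. mulx i g \<beta> T - mulx j g \<beta> T = f \<beta> T - swapvars i j f \<beta> T"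
  shows "ddiff N \<tau> i j f = g"
  unfolding ddiff_def
proof (rule the_equality)
  fix g' assume "Ptau N \<tau> g' \<and> (\<forall>\<beta> T. mulx i g' \<beta> T - mulx j g' \<beta> T = f \<beta> T - swapvars i j f \<beta> T)"
  with assms(3) show "g' = g" by (intro mulx_diff_inject[OF assms(1)]) simp
qed (use assms in blast)

definition multilinear :: "('a::field) ptau \<Rightarrow> bool" where
  "multilinear f \<longleftrightarrow> (\<forall>\<beta> T. f \<beta> T \<noteq> 0 \<longrightarrow> (\<forall>k. \<beta> k \<le> 1))"

lemma multilinear_zero: "multilinear f \<Longrightarrow> 1 < \<beta> k \<Longrightarrow> f \<beta> T = 0"
  unfolding multilinear_def by (meson not_le)

lemma Ptau_Vspace: "Ptau N \<tau> f \<Longrightarrow> f \<beta> \<in> Vspace N \<tau>"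
  by (auto simp: Ptau_def Vspace_def)

lemma comp_tr: "i \<noteq> j \<Longrightarrow> \<beta> \<circ> tr i j = \<beta>(i := \<beta> j, j := \<beta> i)"
  by (auto simp: fun_eq_iff tr_def)

lemma comp_tr_same: "\<beta> i = \<beta> j \<Longrightarrow> \<beta> \<circ> tr i j = \<beta>"
  by (auto simp: fun_eq_iff tr_def)

text \<open>In f = p00 + p10 x_i + p01 x_j + p11 x_i x_j the terms p00 and p11 are symmetric in x_i
  and x_j and cancel, which leaves the quotient p10 - p01.\<close>

lemma ddiff_multilinear:
  assumes f: "Ptau N \<tau> f" "multilinear f" and ij: "i \<noteq> j"
  shows "ddiff N \<tau> i j f = (\<lambda>\<beta> T. if \<beta> i = 0 \<and> \<beta> j = 0 then f (\<beta>(i := 1)) T - f (\<beta>(j := 1)) T else 0)"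
    (is "_ = ?g")
proof (rule ddiff_eqI[OF ij])
  show "Ptau N \<tau> ?g"
    unfolding Ptau_def
  proof (intro conjI allI impI)
    let ?S = "{\<beta>. \<exists>T. f \<beta> T \<noteq> 0}"
    show "finite {\<beta>. \<exists>T. ?g \<beta> T \<noteq> 0}"
    proof (rule finite_subset)
      show "{\<beta>. \<exists>T. ?g \<beta> T \<noteq> 0} \<subseteq> (\<lambda>\<beta>. \<beta>(i := 0)) ` ?S \<union> (\<lambda>\<beta>. \<beta>(j := 0)) ` ?S"
      proof
        fix \<beta> assume "\<beta> \<in> {\<beta>. \<exists>T. ?g \<beta> T \<noteq> 0}"
        then obtain T where z: "\<beta> i = 0" "\<beta> j = 0" and "f (\<beta>(i := 1)) T - f (\<beta>(j := 1)) T \<noteq> 0"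
          by (auto split: if_splits)
        then have "\<beta>(i := 1) \<in> ?S \<or> \<beta>(j := 1) \<in> ?S" by auto
        moreover have "\<beta> = (\<beta>(i := 1))(i := 0)" "\<beta> = (\<beta>(j := 1))(j := 0)" using z by auto
        ultimately show "\<beta> \<in> (\<lambda>\<beta>. \<beta>(i := 0)) ` ?S \<union> (\<lambda>\<beta>. \<beta>(j := 0)) ` ?S" by blast
      qed
    qed (use f in \<open>simp add: Ptau_def\<close>)
  next
    fix \<beta> T assume "?g \<beta> T \<noteq> 0"
    then have z: "\<beta> i = 0" "\<beta> j = 0" and "f (\<beta>(i := 1)) T \<noteq> 0 \<or> f (\<beta>(j := 1)) T \<noteq> 0"
      by (auto split: if_splits)
    then obtain k where k: "f (\<beta>(k := 1)) T \<noteq> 0" "\<beta> k = 0" by auto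
    with f(1) show "T \<in> RSYT N \<tau>" by (auto simp: Ptau_def)
    fix n assume "\<beta> n \<noteq> 0"
    with k have "(\<beta>(k := 1)) n \<noteq> 0" by auto
    with f(1) k show "n \<in> {1..N}" unfolding Ptau_def by blast
  qed
  fix \<beta> T
  \<comment> \<open>Only the exponents at \<open>i\<close> and \<open>j\<close> vary. With the
    others frozen, the identity is a finite check on pairs of exponents.\<close>
  define F where "F x y = f (\<beta>(i := x, j := y)) T" for x y
  have F0: "F x y = 0" if "1 < x \<or> 1 < y" for x y
    using that multilinear_zero[OF f(2), of "\<beta>(i := x, j := y)" i] multilinear_zero[OF f(2), of "\<beta>(i := x, j := y)" j] ij
    by (auto simp: F_def)
  have up: "f (\<beta>(i := x)) T = F x (\<beta> j)" "f (\<beta>(j := y)) T = F (\<beta> i) y" "f \<beta> T = F (\<beta> i) (\<beta> j)" for x y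
    using ij by (simp_all add: F_def fun_upd_idem)
  have up2: "f (\<beta>(i := x, j := y)) T = F x y" "f (\<beta>(j := y, i := x)) T = F x y" for x y
    using ij by (simp_all add: F_def fun_upd_twist)
  have "\<beta> i = 0 \<or> \<beta> i = 1 \<or> \<beta> i = 2 \<or> \<beta> i > 2" "\<beta> j = 0 \<or> \<beta> j = 1 \<or> \<beta> j = 2 \<or> \<beta> j > 2"
    by linarith+
  then show "mulx i ?g \<beta> T - mulx j ?g \<beta> T = f \<beta> T - swapvars i j f \<beta> T"
    using ij by (elim disjE; simp add: mulx_def swapvars_def comp_tr up up2 F0)
qed

text \<open>With f split as p00 + p10 x_i + p01 x_j + p11 x_i x_j, the quotient for x_i f is p00 +
  p10 (x_i + x_j) + p11 x_i x_j. It differs from f only at x_j, where p10 replaces p01.\<close>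

lemma ddiff_mulx_multilinear:
  assumes f: "Ptau N \<tau> f" "multilinear f" and ij: "i \<noteq> j" "i \<in> {1..N}" "j \<in> {1..N}"
  shows "ddiff N \<tau> i j (mulx i f) = (\<lambda>\<beta> T. if \<beta> i = 0 \<and> \<beta> j = 1 then f (\<beta> \<circ> tr i j) T else f \<beta> T)"
    (is "_ = ?g")
proof (rule ddiff_eqI[OF ij(1)])
  show "Ptau N \<tau> ?g"
    unfolding Ptau_def
  proof (intro conjI allI impI)
    let ?S = "{\<beta>. \<exists>T. f \<beta> T \<noteq> 0}"
    show "finite {\<beta>. \<exists>T. ?g \<beta> T \<noteq> 0}"
    proof (rule finite_subset)
      show "{\<beta>. \<exists>T. ?g \<beta> T \<noteq> 0} \<subseteq> ?S \<union> (\<lambda>\<beta>. \<beta> \<circ> tr i j) ` ?S"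
      proof
        fix \<beta> assume "\<beta> \<in> {\<beta>. \<exists>T. ?g \<beta> T \<noteq> 0}"
        then have "\<beta> \<in> ?S \<or> \<beta> \<circ> tr i j \<in> ?S" by (auto split: if_splits)
        moreover have "\<beta> = (\<beta> \<circ> tr i j) \<circ> tr i j" by (simp add: comp_assoc)
        ultimately show "\<beta> \<in> ?S \<union> (\<lambda>\<beta>. \<beta> \<circ> tr i j) ` ?S" by blast
      qed
    qed (use f in \<open>simp add: Ptau_def\<close>)
  next
    fix \<beta> T assume "?g \<beta> T \<noteq> 0"
    then have g: "f \<beta> T \<noteq> 0 \<or> f (\<beta> \<circ> tr i j) T \<noteq> 0" by (auto split: if_splits)
    with f(1) show "T \<in> RSYT N \<tau>" by (auto simp: Ptau_def)
    fix n assume n: "\<beta> n \<noteq> 0"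
    show "n \<in> {1..N}"
    proof (cases "n = i \<or> n = j")
      case False
      with n have "(\<beta> \<circ> tr i j) n \<noteq> 0" by (simp add: tr_def)
      with n g f(1) show ?thesis unfolding Ptau_def by blast
    qed (use ij in blast)
  qed
  fix \<beta> T
  define F where "F x y = f (\<beta>(i := x, j := y)) T" for x y
  have F0: "F x y = 0" if "1 < x \<or> 1 < y" for x y
    using that multilinear_zero[OF f(2), of "\<beta>(i := x, j := y)" i] multilinear_zero[OF f(2), of "\<beta>(i := x, j := y)" j] ij
    by (auto simp: F_def)
  have up: "f (\<beta>(i := x)) T = F x (\<beta> j)" "f (\<beta>(j := y)) T = F (\<beta> i) y" "f \<beta> T = F (\<beta> i) (\<beta> j)" for x y
    using ij by (simp_all add: F_def fun_upd_idem)
  have up2: "f (\<beta>(i := x, j := y)) T = F x y" "f (\<beta>(j := y, i := x)) T = F x y" for x y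
    using ij by (simp_all add: F_def fun_upd_twist)
  have "\<beta> i = 0 \<or> \<beta> i = 1 \<or> \<beta> i = 2 \<or> \<beta> i > 2" "\<beta> j = 0 \<or> \<beta> j = 1 \<or> \<beta> j = 2 \<or> \<beta> j > 2"
    by linarith+
  then show "mulx i ?g \<beta> T - mulx j ?g \<beta> T = mulx i f \<beta> T - swapvars i j (mulx i f) \<beta> T"
    using ij(1) by (elim disjE; simp add: mulx_def swapvars_def comp_tr up up2 F0)
qed

text \<open>Stated at \<open>\<gamma>\<close>, that is, as a coefficient of x_i D_i f, so that it
  can be compared with the degree-preserving U_i. If \<open>\<beta> j = 1\<close>, the exponent
  \<open>\<gamma>\<close> is symmetric in \<open>i\<close> and \<open>j\<close>, and the summand is
  0 as it should be.\<close>

lemma Dunkl_multilinear: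
  assumes f: "Ptau N \<tau> f" "multilinear f"
  shows "Dunkl N \<tau> \<kappa> i f \<beta> T = (if \<beta> i = 0 then let \<gamma> = \<beta>(i := 1) in
    f \<gamma> T + \<kappa> * (\<Sum>j\<in>{1..N} - {i}. rep_perm N \<tau> (tr i j) (f \<gamma>) T - rep_perm N \<tau> (tr i j) (f (\<gamma> \<circ> tr i j)) T)
    else 0)"
proof (cases "\<beta> i = 0")
  case True
  define \<gamma> where "\<gamma> = \<beta>(i := 1)"
  have "mapV (rep_perm N \<tau> (tr i j)) (ddiff N \<tau> i j f) \<beta> T =
      rep_perm N \<tau> (tr i j) (f \<gamma>) T - rep_perm N \<tau> (tr i j) (f (\<gamma> \<circ> tr i j)) T"
    if j: "j \<in> {1..N} - {i}" for j
  proof -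
    have "ddiff N \<tau> i j f \<beta> = (\<lambda>T. f \<gamma> T - f (\<gamma> \<circ> tr i j) T)"
    proof -
      consider "\<beta> j = 0" | "\<beta> j = 1" | "\<beta> j > 1" by linarith
      then show ?thesis
      proof cases
        case 1
        have "\<gamma> \<circ> tr i j = \<beta>(j := 1)" using True 1 j by (auto simp: \<gamma>_def fun_eq_iff tr_def)
        with 1 True j show ?thesis by (simp add: ddiff_multilinear[OF f] \<gamma>_def)
      next
        case 2
        then have "\<gamma> \<circ> tr i j = \<gamma>" using j by (intro comp_tr_same) (auto simp: \<gamma>_def)
        with 2 j show ?thesis by (simp add: ddiff_multilinear[OF f])
      next
        case 3
        have "f \<gamma> T = 0" "f (\<gamma> \<circ> tr i j) T = 0" for T
          using 3 j multilinear_zero[OF f(2), of \<gamma> j] multilinear_zero[OF f(2), of "\<gamma> \<circ> tr i j" i]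
          by (auto simp: \<gamma>_def tr_def)
        with 3 j show ?thesis by (simp add: ddiff_multilinear[OF f])
      qed
    qed
    then show ?thesis by (simp add: mapV_def rep_perm_diff)
  qed
  then show ?thesis using True by (simp add: Dunkl_def dx_def Let_def \<gamma>_def)
next
  case False
  then have "mapV (rep_perm N \<tau> (tr i j)) (ddiff N \<tau> i j f) \<beta> T = 0" if "j \<in> {1..N} - {i}" for j
    using that by (simp add: mapV_def ddiff_multilinear[OF f] rep_perm_zero)
  moreover have "dx i f \<beta> T = 0"
    using False multilinear_zero[OF f(2), of "\<beta>(i := Suc (\<beta> i))" i] by (simp add: dx_def)
  ultimately show ?thesis using False by (simp add: Dunkl_def)
qed

lemma Ucal_mulx:
  assumes f: "Ptau N \<tau> f" "multilinear f" and i: "i \<in> {1..N}"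
  shows "Ucal N \<tau> \<kappa> i f \<beta> T = of_nat (Suc (\<beta> i)) * f \<beta> T +
    \<kappa> * (\<Sum>j\<in>{1..N} - {i}. rep_perm N \<tau> (tr i j) (if \<beta> i = 0 \<and> \<beta> j = 1 then f (\<beta> \<circ> tr i j) else f \<beta>) T)
    - \<kappa> * (\<Sum>j\<in>{1..<i}. rep_perm N \<tau> (tr i j) (f (\<beta> \<circ> tr i j)) T)"
proof -
  have "mapV (rep_perm N \<tau> (tr i j)) (ddiff N \<tau> i j (mulx i f)) \<beta> T =
    rep_perm N \<tau> (tr i j) (if \<beta> i = 0 \<and> \<beta> j = 1 then f (\<beta> \<circ> tr i j) else f \<beta>) T" if "j \<in> {1..N} - {i}" for j
  proof -
    have "ddiff N \<tau> i j (mulx i f) \<beta> = (if \<beta> i = 0 \<and> \<beta> j = 1 then f (\<beta> \<circ> tr i j) else f \<beta>)"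
      using that i by (subst ddiff_mulx_multilinear[OF f]) auto
    then show ?thesis by (simp only: mapV_def)
  qed
  then show ?thesis
    by (simp add: Ucal_def Dunkl_def dx_def mulx_def mapV_def swapvars_def)
qed

text \<open>When x_i is absent, every difference quotient contributes the coefficient at the swapped
  exponent. The correction term of U_i then removes precisely the summands with \<open>j < i\<close>
  and leaves the Jucys-Murphy sum.\<close>

lemma Ucal_multilinear_0:
  assumes f: "Ptau N \<tau> f" "multilinear f" and i: "i \<in> {1..N}" and b: "\<beta> i = 0"
  shows "Ucal N \<tau> \<kappa> i f \<beta> T = f \<beta> T + \<kappa> * (\<Sum>j\<in>{i<..N}. rep_perm N \<tau> (tr i j) (f (\<beta> \<circ> tr i j)) T)"
proof -
  have "(if \<beta> i = 0 \<and> \<beta> j = 1 then f (\<beta> \<circ> tr i j) else f \<beta>) = f (\<beta> \<circ> tr i j)" if "j \<noteq> i" for j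
  proof -
    consider "\<beta> j = 0" | "\<beta> j = 1" | "\<beta> j > 1" by linarith
    then show ?thesis
    proof cases
      case 1
      then show ?thesis using b by (simp add: comp_tr_same)
    next
      case 3
      have "f \<beta> T = 0" "f (\<beta> \<circ> tr i j) T = 0" for T
        using 3 that multilinear_zero[OF f(2), of \<beta> j] multilinear_zero[OF f(2), of "\<beta> \<circ> tr i j" i]
        by (auto simp: tr_def)
      then show ?thesis by (simp add: fun_eq_iff)
    qed (simp add: b)
  qed
  then have "(\<Sum>j\<in>{1..N} - {i}. rep_perm N \<tau> (tr i j) (if \<beta> i = 0 \<and> \<beta> j = 1 then f (\<beta> \<circ> tr i j) else f \<beta>) T)
    = (\<Sum>j\<in>{1..N} - {i}. rep_perm N \<tau> (tr i j) (f (\<beta> \<circ> tr i j)) T)"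
    by (intro sum.cong) auto
  also have "\<dots> = (\<Sum>j\<in>{1..<i} \<union> {i<..N}. rep_perm N \<tau> (tr i j) (f (\<beta> \<circ> tr i j)) T)"
    using i by (intro sum.cong) auto
  also have "\<dots> =
    (\<Sum>j\<in>{1..<i}. rep_perm N \<tau> (tr i j) (f (\<beta> \<circ> tr i j)) T) + (\<Sum>j\<in>{i<..N}. rep_perm N \<tau> (tr i j) (f (\<beta> \<circ> tr i j)) T)"
    by (intro sum.union_disjoint) auto
  finally show ?thesis using b unfolding Ucal_mulx[OF f i] by (simp add: algebra_simps)
qed

lemma Ucal_multilinear_1:
  assumes f: "Ptau N \<tau> f" "multilinear f" and i: "i \<in> {1..N}" and b: "\<beta> i = 1"
  shows "Ucal N \<tau> \<kappa> i f \<beta> T = 2 * f \<beta> T + \<kappa> * (\<Sum>j\<in>{1..N} - {i}. rep_perm N \<tau> (tr i j) (f \<beta>) T)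
    - \<kappa> * (\<Sum>j\<in>{1..<i}. rep_perm N \<tau> (tr i j) (f (\<beta> \<circ> tr i j)) T)"
  using b by (simp add: Ucal_mulx[OF f i])

section \<open>Ranks, the dominance order and the support of zeta\<close>

lemma rank_less:
  assumes "i \<in> {1..N}" "j \<in> {1..N}" "\<beta> j < \<beta> i"
  shows "rank N \<beta> i < rank N \<beta> j"
proof -
  have "rank N \<beta> i = card ({k \<in> {1..N}. \<beta> i < \<beta> k} \<union> {k \<in> {1..i}. \<beta> k = \<beta> i})"
    unfolding rank_def by (rule card_Un_disjoint[symmetric]) auto
  also have "\<dots> \<le> card {k \<in> {1..N}. \<beta> j < \<beta> k}"
    using assms by (intro card_mono) auto
  also have "\<dots> < rank N \<beta> j"
    using assms by (auto simp: rank_def card_gt_0_iff)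
  finally show ?thesis .
qed

lemma rank_less_eq_value:
  assumes "i < j" "\<beta> i = \<beta> j" "1 \<le> j"
  shows "rank N \<beta> i < rank N \<beta> j"
proof -
  have "card {k \<in> {1..i}. \<beta> k = \<beta> i} < card {k \<in> {1..j}. \<beta> k = \<beta> j}"
  proof (rule psubset_card_mono)
    have "j \<in> {k \<in> {1..j}. \<beta> k = \<beta> j}" "j \<notin> {k \<in> {1..i}. \<beta> k = \<beta> i}" using assms by auto
    moreover have "{k \<in> {1..i}. \<beta> k = \<beta> i} \<subseteq> {k \<in> {1..j}. \<beta> k = \<beta> j}" using assms by auto
    ultimately show "{k \<in> {1..i}. \<beta> k = \<beta> i} \<subset> {k \<in> {1..j}. \<beta> k = \<beta> j}" by blast
  qed simp
  with assms show ?thesis by (simp add: rank_def)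
qed

lemma rank_perm_permutes: "rank_perm N \<beta> permutes {1..N}"
proof (rule bij_imp_permutes)
  have "rank N \<beta> i \<in> {1..N}" if i: "i \<in> {1..N}" for i
  proof -
    have "rank N \<beta> i = card ({k \<in> {1..N}. \<beta> i < \<beta> k} \<union> {k \<in> {1..i}. \<beta> k = \<beta> i})"
      unfolding rank_def by (rule card_Un_disjoint[symmetric]) auto
    also have "\<dots> \<le> card {1..N}" using i by (intro card_mono) auto
    finally have "rank N \<beta> i \<le> N" by simp
    moreover have "0 < card {k \<in> {1..i}. \<beta> k = \<beta> i}" using i by (auto simp: card_gt_0_iff)
    ultimately show ?thesis by (simp add: rank_def)
  qed
  moreover have "inj_on (rank_perm N \<beta>) {1..N}"
  proof (rule inj_onI)
    fix i j assume ij: "i \<in> {1..N}" "j \<in> {1..N}" "rank_perm N \<beta> i = rank_perm N \<beta> j"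
    then have r: "rank N \<beta> i = rank N \<beta> j" by (simp add: rank_perm_def)
    then have "\<beta> i = \<beta> j" using rank_less[OF ij(1,2), of \<beta>] rank_less[OF ij(2,1), of \<beta>] by force
    with r ij rank_less_eq_value[of i j \<beta> N] rank_less_eq_value[of j i \<beta> N] show "i = j" by force
  qed
  ultimately show "bij_betw (rank_perm N \<beta>) {1..N} {1..N}"
    unfolding bij_betw_def by (intro conjI endo_inj_surj) (auto simp: rank_perm_def)
qed (auto simp: rank_perm_def)

lemma le_plus_part_1:
  assumes k: "k \<in> {1..N}"
  shows "\<beta> k \<le> plus_part N \<beta> 1"
proof -
  define i where "i = inv (rank_perm N \<beta>) 1"
  note r = rank_perm_permutes[of N \<beta>]
  have one: "1 \<in> {1..N}" using k by auto
  have i: "i \<in> {1..N}" unfolding i_def using permutes_in_image[OF permutes_inv[OF r]] one by blast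
  have "rank_perm N \<beta> i = 1" unfolding i_def using permutes_inverses(1)[OF r] by simp
  then have ri: "rank N \<beta> i = 1" using i by (simp add: rank_perm_def)
  have "\<not> \<beta> i < \<beta> k"
  proof
    assume "\<beta> i < \<beta> k"
    with rank_less[where \<beta> = \<beta>, OF k i] ri have "rank N \<beta> k = 0" by simp
    with k show False by (auto simp: rank_def)
  qed
  then show ?thesis using one by (simp add: plus_part_def i_def)
qed

lemma rank_alpha:
  assumes "last \<tau> \<le> N" "i \<in> {1..N}"
  shows "rank N (alpha \<tau>) i = i"
proof (cases "i \<le> last \<tau>")
  case True
  then have "{j \<in> {1..N}. alpha \<tau> i < alpha \<tau> j} = {}" "{j \<in> {1..i}. alpha \<tau> j = alpha \<tau> i} = {1..i}"
    using assms by (auto simp: alpha_def)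
  then show ?thesis by (simp only: rank_def) simp
next
  case False
  then have "{j \<in> {1..N}. alpha \<tau> i < alpha \<tau> j} = {1..last \<tau>}" "{j \<in> {1..i}. alpha \<tau> j = alpha \<tau> i} = {last \<tau><..i}"
    using assms by (auto simp: alpha_def)
  then show ?thesis using False by (simp only: rank_def) simp
qed

lemma rank_perm_alpha: "last \<tau> \<le> N \<Longrightarrow> rank_perm N (alpha \<tau>) = id"
  using rank_alpha[of \<tau> N] by (auto simp: rank_perm_def fun_eq_iff)

lemma sum_alpha: "last \<tau> \<le> N \<Longrightarrow> (\<Sum>k=1..N. alpha \<tau> k) = last \<tau>"
proof -
  assume "last \<tau> \<le> N"
  then have "(\<Sum>k=1..N. alpha \<tau> k) = (\<Sum>k=1..last \<tau>. 1)"
    by (intro sum.mono_neutral_cong_right) (auto simp: alpha_def)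
  then show ?thesis by simp
qed

text \<open>The first partial sum in the dominance order bounds the largest exponent of
  \<open>\<gamma>\<close> by that of alpha. Hence zeta is multilinear.\<close>

lemma dom_lhd_alpha:
  assumes m: "last \<tau> \<le> N" and d: "dom_lhd N \<gamma> (alpha \<tau>)" and k: "k \<in> {1..N}"
  shows "\<gamma> k \<le> 1"
proof -
  have one: "1 \<in> {1..N}" using k by auto
  have "plus_part N \<gamma> = plus_part N (alpha \<tau>) \<or>
      (\<forall>i\<in>{1..N}. (\<Sum>j=1..i. plus_part N \<gamma> j) \<le> (\<Sum>j=1..i. plus_part N (alpha \<tau>) j))"
    using d unfolding dom_lhd_def dom_prec_def by blast
  then have "plus_part N \<gamma> 1 \<le> plus_part N (alpha \<tau>) 1"
    using one by (auto dest!: bspec[where x = 1])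
  also have "\<dots> \<le> 1" by (simp add: plus_part_def alpha_def)
  finally show ?thesis using le_plus_part_1[OF k, of \<gamma>] by simp
qed

lemma nsJack_support:
  assumes m: "last \<tau> \<le> N" and J: "is_nsJack N \<tau> \<kappa> (alpha \<tau>) T \<zeta>" and nz: "\<zeta> \<gamma> S \<noteq> 0"
  shows "\<gamma> k \<le> 1" "k \<notin> {1..N} \<Longrightarrow> \<gamma> k = 0" "(\<Sum>k=1..N. \<gamma> k) = last \<tau>"
proof -
  show out: "\<gamma> k = 0" if "k \<notin> {1..N}" for k
    using J nz that unfolding is_nsJack_def Ptau_def by blast
  have d: "\<gamma> = alpha \<tau> \<or> dom_lhd N \<gamma> (alpha \<tau>)" using J nz unfolding is_nsJack_def by blast
  then show "(\<Sum>k=1..N. \<gamma> k) = last \<tau>" using sum_alpha[OF m] by (auto simp: dom_lhd_def)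
  show "\<gamma> k \<le> 1"
    using d dom_lhd_alpha[OF m, of \<gamma> k] out[of k] by (cases "k \<in> {1..N}") (auto simp: alpha_def)
qed

section \<open>Specialisation of rational functions\<close>

text \<open>One relation for "no pole at x, and value v there". Unlike \<open>eval_at\<close> it can
  be propagated through sums, products and quotients without separate regularity conditions.\<close>

definition fract_value :: "real \<Rightarrow> real poly fract \<Rightarrow> real \<Rightarrow> bool" where
  "fract_value x r v \<longleftrightarrow> (\<exists>p q. poly q x \<noteq> 0 \<and> r = Fract p q \<and> v = poly p x / poly q x)"

lemma fract_value_unique:
  assumes "fract_value x r v" "fract_value x r v'" shows "v = v'"
proof -
  obtain p q where 1: "poly q x \<noteq> 0" "r = Fract p q" "v = poly p x / poly q x"
    using assms(1) by (auto simp: fract_value_def)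
  obtain p' q' where 2: "poly q' x \<noteq> 0" "r = Fract p' q'" "v' = poly p' x / poly q' x"
    using assms(2) by (auto simp: fract_value_def)
  have "q \<noteq> 0" "q' \<noteq> 0" using 1 2 by auto
  then have "p * q' = p' * q" using 1 2 by (simp add: eq_fract)
  then have "poly p x * poly q' x = poly p' x * poly q x" by (metis poly_mult)
  then show ?thesis using 1 2 by (simp add: frac_eq_eq)
qed

lemma fract_value_eval: "fract_value x r v \<Longrightarrow> regular_at x r \<and> eval_at x r = v"
proof
  assume v: "fract_value x r v"
  then show "regular_at x r" by (auto simp: fract_value_def regular_at_def)
  show "eval_at x r = v"
    unfolding eval_at_def fract_value_def[symmetric]
    using v by (intro the_equality) (auto intro: fract_value_unique)
qed

lemma fract_value_add:
  assumes "fract_value x r v" "fract_value x s w" shows "fract_value x (r + s) (v + w)"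
proof -
  obtain p q where 1: "poly q x \<noteq> 0" "r = Fract p q" "v = poly p x / poly q x"
    using assms(1) by (auto simp: fract_value_def)
  obtain p' q' where 2: "poly q' x \<noteq> 0" "s = Fract p' q'" "w = poly p' x / poly q' x"
    using assms(2) by (auto simp: fract_value_def)
  have "q \<noteq> 0" "q' \<noteq> 0" using 1 2 by auto
  then have "r + s = Fract (p * q' + p' * q) (q * q')" using 1 2 by simp
  then show ?thesis
    using 1 2 unfolding fract_value_def
    by (intro exI[of _ "p * q' + p' * q"] exI[of _ "q * q'"]) (simp add: add_frac_eq)
qed

lemma fract_value_mult:
  assumes "fract_value x r v" "fract_value x s w" shows "fract_value x (r * s) (v * w)"
proof -
  obtain p q where 1: "poly q x \<noteq> 0" "r = Fract p q" "v = poly p x / poly q x"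
    using assms(1) by (auto simp: fract_value_def)
  obtain p' q' where 2: "poly q' x \<noteq> 0" "s = Fract p' q'" "w = poly p' x / poly q' x"
    using assms(2) by (auto simp: fract_value_def)
  show ?thesis
    using 1 2 unfolding fract_value_def by (intro exI[of _ "p * p'"] exI[of _ "q * q'"]) simp
qed

lemma fract_value_inverse:
  assumes "fract_value x r v" "v \<noteq> 0" shows "fract_value x (inverse r) (inverse v)" "r \<noteq> 0"
proof -
  obtain p q where 1: "poly q x \<noteq> 0" "r = Fract p q" "v = poly p x / poly q x"
    using assms(1) by (auto simp: fract_value_def)
  with assms(2) show "fract_value x (inverse r) (inverse v)"
    unfolding fract_value_def by (intro exI[of _ q] exI[of _ p]) auto
  have "p \<noteq> 0" "q \<noteq> 0" using 1 assms(2) by auto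
  with 1 show "r \<noteq> 0" by (simp add: Zero_fract_def eq_fract)
qed

lemma fract_value_const: "fract_value x (Fract [:c:] 1) c"
  unfolding fract_value_def by (intro exI[of _ "[:c:]"] exI[of _ 1]) simp

lemma fract_value_0: "fract_value x 0 0"
  using fract_value_const[of x 0] by (simp add: Zero_fract_def)

lemma fract_value_1: "fract_value x 1 1"
  using fract_value_const[of x 1] by (simp add: One_fract_def one_pCons)

lemma fract_value_minus: "fract_value x r v \<Longrightarrow> fract_value x (- r) (- v)"
proof -
  have "fract_value x (- 1) (- 1)"
    using fract_value_const[of x "-1"] by (simp add: One_fract_def one_pCons)
  moreover assume "fract_value x r v"
  ultimately show ?thesis using fract_value_mult by fastforce
qed

lemma fract_value_diff: "fract_value x r v \<Longrightarrow> fract_value x s w \<Longrightarrow> fract_value x (r - s) (v - w)"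
  using fract_value_add[of x r v "- s" "- w"] fract_value_minus by simp

lemma fract_value_of_nat: "fract_value x (of_nat n) (of_nat n)"
  by (induction n) (auto intro: fract_value_0 fract_value_1 fract_value_add)

lemma fract_value_of_int: "fract_value x (of_int n) (of_int n)"
  by (cases n rule: int_cases2) (simp_all add: fract_value_of_nat fract_value_minus)

lemma fract_value_divide:
  "fract_value x r v \<Longrightarrow> fract_value x s w \<Longrightarrow> w \<noteq> 0 \<Longrightarrow> fract_value x (r / s) (v / w)"
  unfolding divide_inverse by (intro fract_value_mult fract_value_inverse)

lemma fract_value_power: "fract_value x r v \<Longrightarrow> fract_value x (r ^ n) (v ^ n)"
  by (induction n) (auto intro: fract_value_1 fract_value_mult)

lemma fract_value_sum: "(\<And>i. i \<in> I \<Longrightarrow> fract_value x (f i) (g i)) \<Longrightarrow> fract_value x (sum f I) (sum g I)"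
  by (induction I rule: infinite_finite_induct) (auto intro: fract_value_0 fract_value_add)

lemma fract_value_kappa: "fract_value x kappa_indet x"
  unfolding fract_value_def kappa_indet_def by (intro exI[of _ "[:0, 1:]"] exI[of _ 1]) simp

lemma fract_value_cancel:
  assumes "fract_value x (r * s) (v * w)" "fract_value x r v" "v \<noteq> 0"
  shows "fract_value x s w"
  using fract_value_mult[OF fract_value_inverse(1)[OF assms(2,3)] assms(1)] fract_value_inverse(2)[OF assms(2,3)] assms(3)
  by (simp add: mult.assoc[symmetric])

section \<open>Specialisation commutes with the representation\<close>

lemma fract_value_bvec: "fract_value x (bvec T S) (bvec T S)"
  by (simp add: bvec_def fract_value_0 fract_value_1)

text \<open>The two occurrences of \<open>sgen\<close> live over different fields, rational
  functions and reals. The seminormal entries are rational numbers, so the first specialises to the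
  second at every point.\<close>

lemma fract_value_sgen: "fract_value x (sgen \<tau> i T S) (sgen \<tau> i T S)"
  unfolding sgen_def Let_def
  by (auto intro!: fract_value_bvec fract_value_0 fract_value_1 fract_value_minus fract_value_add fract_value_mult
      fract_value_diff fract_value_divide fract_value_power fract_value_of_int)

lemma fract_value_rep_perm:
  assumes "\<And>S. fract_value x (v S) (v' S)"
  shows "fract_value x (rep_perm N \<tau> w v S) (rep_perm N \<tau> w v' S)"
proof -
  have "\<forall>S. fract_value x (rep_word N \<tau> ws v S) (rep_word N \<tau> ws v' S)" for ws
    using assms
    by (induction ws) (auto simp: rep_word_def repS_def intro!: fract_value_sum fract_value_mult fract_value_sgen)
  then show ?thesis by (simp add: rep_perm_def)
qed

text \<open>After conjugation by \<open>w\<close> the operator a - k (sum of the (i j) over J) is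
  diagonal with entries a - k c(n,S). By \<open>nz\<close> their values at \<open>x\<close> are
  nonzero, so each coordinate can be divided by its entry without creating a pole.\<close>

lemma fract_value_resolvent:
  assumes P: "is_partition N \<tau>" and i: "i \<in> {1..N}" and J: "J \<subseteq> {1..N} - {i}"
    and v: "v \<in> Vspace N \<tau>" and v': "v' \<in> Vspace N \<tau>"
    and a: "fract_value x a a'" and k: "fract_value x k k'"
    and nz: "\<And>S n. S \<in> RSYT N \<tau> \<Longrightarrow> n \<in> {1..N} \<Longrightarrow> a' - k' * of_int (content \<tau> S n) \<noteq> 0"
    and eq: "\<And>S. fract_value x (a * v S - k * (\<Sum>j\<in>J. rep_perm N \<tau> (tr i j) v S))
      (a' * v' S - k' * (\<Sum>j\<in>J. rep_perm N \<tau> (tr i j) v' S))"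
  shows "fract_value x (v S) (v' S)"
proof -
  obtain w n where w: "w permutes {1..N}" "n \<in> {1..N}" "w n = i" "w ` {n<..N} = J"
    using sorting_perm_exists[OF i J] by blast
  note iw = permutes_inv[OF w(1)]
  \<comment> \<open>Stated over an arbitrary field, since it is applied both to \<open>v\<close>
    over rational functions and to \<open>v'\<close> over the reals.\<close>
  have conj: "rep_perm N \<tau> (inv w) (\<lambda>S. b * u S - c * (\<Sum>j\<in>J. rep_perm N \<tau> (tr i j) u S)) S =
      (b - c * of_int (content \<tau> S n)) * rep_perm N \<tau> (inv w) u S"
    if u: "u \<in> Vspace N \<tau>" for b c :: "'b::field_char_0" and u S
  proof -
    define y where "y = (\<lambda>S. of_int (content \<tau> S n) * rep_perm N \<tau> (inv w) u S)"
    have y: "y \<in> Vspace N \<tau>"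
      using rep_perm_Vspace[OF P iw u] by (simp add: y_def Vspace_def)
    have "(\<lambda>S. b * u S - c * (\<Sum>j\<in>J. rep_perm N \<tau> (tr i j) u S)) = (\<lambda>S. b * u S - c * rep_perm N \<tau> w y S)"
      using transposition_sum_conj[OF P w(1,2) u] by (simp add: w(3,4) y_def)
    then have "rep_perm N \<tau> (inv w) (\<lambda>S. b * u S - c * (\<Sum>j\<in>J. rep_perm N \<tau> (tr i j) u S)) S =
      b * rep_perm N \<tau> (inv w) u S - c * rep_perm N \<tau> (inv w) (rep_perm N \<tau> w y) S"
      by (simp add: rep_perm_diff rep_perm_scale)
    also have "rep_perm N \<tau> (inv w) (rep_perm N \<tau> w y) = y" by (rule rep_perm_inverse(2)[OF P w(1) y])
    finally show ?thesis by (simp add: y_def algebra_simps)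
  qed
  have "fract_value x (rep_perm N \<tau> (inv w) v S) (rep_perm N \<tau> (inv w) v' S)" for S
  proof (cases "S \<in> RSYT N \<tau>")
    case True
    have "fract_value x ((a - k * of_int (content \<tau> S n)) * rep_perm N \<tau> (inv w) v S)
      ((a' - k' * of_int (content \<tau> S n)) * rep_perm N \<tau> (inv w) v' S)"
      unfolding conj[OF v, symmetric] conj[OF v', symmetric] by (rule fract_value_rep_perm[OF eq])
    then show ?thesis
      by (rule fract_value_cancel) (intro fract_value_diff fract_value_mult a k fract_value_of_int, rule nz[OF True w(2)])
  next
    case False
    then have "rep_perm N \<tau> (inv w) v S = 0" "rep_perm N \<tau> (inv w) v' S = 0"
      using rep_perm_Vspace[OF P iw v] rep_perm_Vspace[OF P iw v'] by (auto simp: Vspace_def)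
    then show ?thesis by (simp add: fract_value_0)
  qed
  then have "fract_value x (rep_perm N \<tau> w (rep_perm N \<tau> (inv w) v) S) (rep_perm N \<tau> w (rep_perm N \<tau> (inv w) v') S)"
    by (rule fract_value_rep_perm)
  then show ?thesis by (simp add: rep_perm_inverse(1)[OF P w(1) v] rep_perm_inverse(1)[OF P w(1) v'])
qed

section \<open>The specialised Jack polynomial\<close>

lemma sum_comp_tr:
  fixes f :: "nat \<Rightarrow> 'b::comm_monoid_add"
  assumes "i \<in> {1..N}" "j \<in> {1..N}"
  shows "(\<Sum>k=1..N. f (tr i j k)) = (\<Sum>k=1..N. f k)"
  using sum.permute[OF tr_permutes[OF assms], of f] unfolding comp_def by (rule sym)

context bottom_row_move
begin

lemma alpha_last: "last \<tau> = m"
  by (simp add: tau)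

lemma singular_vector_range:
  assumes "singular_vector \<beta> S \<noteq> 0"
  shows "\<beta> k \<le> 1" "k \<notin> {1..N} \<Longrightarrow> \<beta> k = 0" "(\<Sum>k=1..N. \<beta> k) = m"
proof -
  obtain w where w: "w permutes {1..N}" "\<beta> = alpha \<tau> \<circ> w" using singular_vector_support[OF assms] .
  show "\<beta> k \<le> 1" by (simp add: w alpha_eq)
  show "\<beta> k = 0" if "k \<notin> {1..N}" using w(1) that m_less_N by (auto simp: w(2) permutes_def alpha_eq)
  have "(\<Sum>k=1..N. \<beta> k) = (\<Sum>k=1..N. alpha \<tau> k)"
    unfolding w(2) by (rule sum.permute[OF w(1), symmetric])
  then show "(\<Sum>k=1..N. \<beta> k) = m" using sum_alpha[of \<tau> N] m_less_N by (simp add: alpha_last)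
qed

lemma singular_vector_multilinear: "multilinear singular_vector"
  using singular_vector_range(1) by (auto simp: multilinear_def)

lemma singular_vector_Ptau: "Ptau N \<tau> singular_vector"
  unfolding Ptau_def
proof (intro conjI allI impI)
  show "finite {\<beta>. \<exists>T. singular_vector \<beta> T \<noteq> 0}"
  proof (rule finite_subset)
    show "{\<beta>. \<exists>T. singular_vector \<beta> T \<noteq> 0} \<subseteq> (\<lambda>w. alpha \<tau> \<circ> w) ` {w. w permutes {1..N}}"
      by (auto elim!: singular_vector_support)
  qed (simp add: finite_permutations)
next
  fix \<beta> T assume nz: "singular_vector \<beta> T \<noteq> 0"
  show "T \<in> RSYT N \<tau>" using nz singular_vector_Vspace[of \<beta>] by (auto simp: Vspace_def)
  fix k assume "\<beta> k \<noteq> 0"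
  then show "k \<in> {1..N}" using singular_vector_range(2)[OF nz, of k] by (rule contrapos_np)
qed

abbreviation "\<kappa>\<^sub>0 \<equiv> 1 / real (h_tau \<tau>)"

lemma h_tau_pos: "0 < real (h_tau \<tau>)"
  using m_pos m_le_a by (simp add: h_tau_eq l_eq)

lemma content_le:
  assumes S: "S \<in> RSYT N \<tau>" and n: "n \<in> {1..N}"
  shows "content \<tau> S n \<le> int a - 1"
proof -
  obtain r c where e: "entry_cell \<tau> S n = (r,c)" by fastforce
  have "(r,c) \<in> cells \<tau>" using entry_cell(1)[OF S n] e by simp
  then have "1 \<le> r" "(1,c) \<in> cells \<tau>" using cells_pos[of r c] cells_down[OF P, of r c 1 c] by auto
  then have "1 \<le> r" "c \<le> a" by (auto simp: cells_def tau)
  then show ?thesis by (simp add: content_def e)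
qed

lemma content_T1_low: "1 \<le> i \<Longrightarrow> i \<le> m \<Longrightarrow> content \<tau> (T1 \<tau>) i = int m + 1 - int i - int l"
  using entry_cell_low(1)[OF T1_Y0, of i] by (simp add: content_def of_nat_diff)

text \<open>Multiplied by \<open>h_tau\<close>, the expression is at least (a + l - 1) + (m + 1 - i
  - l) - (a - 1) = m + 1 - i, which is positive.\<close>

lemma recursion_denominator_nonzero:
  assumes S: "S \<in> RSYT N \<tau>" and n: "n \<in> {1..N}" and i: "1 \<le> i" "i \<le> m"
  shows "1 + \<kappa>\<^sub>0 * of_int (content \<tau> (T1 \<tau>) i) - \<kappa>\<^sub>0 * of_int (content \<tau> S n) \<noteq> 0"
proof -
  have "int (h_tau \<tau>) + content \<tau> (T1 \<tau>) i - content \<tau> S n > 0"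
    using content_le[OF S n] content_T1_low[OF i] i m_pos m_le_a by (simp add: h_tau_eq of_nat_diff l_eq)
  then have "real_of_int (int (h_tau \<tau>) + content \<tau> (T1 \<tau>) i - content \<tau> S n) > 0"
    by (simp only: of_int_0_less_iff)
  moreover have "1 + \<kappa>\<^sub>0 * of_int (content \<tau> (T1 \<tau>) i) - \<kappa>\<^sub>0 * of_int (content \<tau> S n) =
      real_of_int (int (h_tau \<tau>) + content \<tau> (T1 \<tau>) i - content \<tau> S n) / real (h_tau \<tau>)"
    using h_tau_pos by (simp add: add_divide_distrib diff_divide_distrib)
  ultimately show ?thesis using h_tau_pos by (metis divide_pos_pos less_irrefl)
qed

section \<open>The value of zeta at kappa_0 and its annihilation by the Dunkl operators\<close>

context
  fixes \<zeta> :: "real poly fract ptau"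
  assumes J: "is_nsJack N \<tau> kappa_indet (alpha \<tau>) (T1 \<tau>) \<zeta>"
begin

lemma last_le: "last \<tau> \<le> N"
  using m_less_N by (simp add: alpha_last)

lemma zeta_Ptau: "Ptau N \<tau> \<zeta>"
  using J by (simp add: is_nsJack_def)

lemma zeta_multilinear: "multilinear \<zeta>"
  using nsJack_support(1)[OF last_le J] by (auto simp: multilinear_def)

lemma zeta_alpha: "\<zeta> (alpha \<tau>) = bvec (T1 \<tau>)"
proof -
  have "\<zeta> (alpha \<tau>) = rep_perm N \<tau> (inv (rank_perm N (alpha \<tau>))) (bvec (T1 \<tau>))"
    using J by (simp add: is_nsJack_def)
  also have "\<dots> = bvec (T1 \<tau>)"
    unfolding rank_perm_alpha[OF last_le] inv_id
    by (rule rep_perm_id[OF P bvec_Vspace[OF T1_RSYT[OF P]]])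
  finally show ?thesis .
qed

lemma zeta_eigen:
  assumes "i \<in> {1..N}"
  shows "Ucal N \<tau> kappa_indet i \<zeta> \<beta> S =
    (of_nat (alpha \<tau> i) + 1 + kappa_indet * of_int (content \<tau> (T1 \<tau>) i)) * \<zeta> \<beta> S"
proof -
  have "Ucal N \<tau> kappa_indet i \<zeta> = (\<lambda>\<gamma> S. (of_nat (alpha \<tau> i) + 1 +
      kappa_indet * of_int (content \<tau> (T1 \<tau>) (rank N (alpha \<tau>) i))) * \<zeta> \<gamma> S)"
    using J assms unfolding is_nsJack_def by blast
  then show ?thesis by (simp only: rank_alpha[OF last_le assms])
qed

text \<open>In the equation for U_i at \<open>\<beta>\<close>, swaps with places in
  \<open>J0\<close> leave \<open>\<beta>\<close> unchanged and belong to the operator to be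
  inverted; swaps with places in \<open>J1\<close> lead to known coefficients.\<close>

lemma zeta_value_recursion:
  assumes i: "1 \<le> i" "i \<le> m" and b: "\<beta> i = 0" "\<And>k. \<beta> k \<le> 1"
    and IH: "\<And>j S. i < j \<Longrightarrow> j \<le> N \<Longrightarrow> \<beta> j = 1 \<Longrightarrow>
      fract_value \<kappa>\<^sub>0 (\<zeta> (\<beta> \<circ> tr i j) S) (singular_vector (\<beta> \<circ> tr i j) S)"
  shows "fract_value \<kappa>\<^sub>0 (\<zeta> \<beta> S) (singular_vector \<beta> S)"
proof -
  define c where "c = content \<tau> (T1 \<tau>) i"
  define J0 J1 where "J0 = {j \<in> {i<..N}. \<beta> j = 0}" and "J1 = {j \<in> {i<..N}. \<beta> j = 1}"
  have iN: "i \<in> {1..N}" using i m_less_N by auto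
  have split: "(\<Sum>j\<in>{i<..N}. rep_perm N \<tau> (tr i j) (f (\<beta> \<circ> tr i j)) S) =
      (\<Sum>j\<in>J0. rep_perm N \<tau> (tr i j) (f \<beta>) S) + (\<Sum>j\<in>J1. rep_perm N \<tau> (tr i j) (f (\<beta> \<circ> tr i j)) S)"
    for f :: "'b::field_char_0 ptau" and S
  proof -
    have "\<beta> j = 0 \<or> \<beta> j = 1" for j using b(2)[of j] by linarith
    then have "{i<..N} = J0 \<union> J1" by (auto simp: J0_def J1_def)
    moreover have "J0 \<inter> J1 = {}" "finite J0" "finite J1" by (auto simp: J0_def J1_def)
    moreover have "\<beta> \<circ> tr i j = \<beta>" if "j \<in> J0" for j
      using that b by (intro comp_tr_same) (simp add: J0_def)
    ultimately show ?thesis by (simp add: sum.union_disjoint)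
  qed
  have z: "(1 + kappa_indet * of_int c) * \<zeta> \<beta> S - kappa_indet * (\<Sum>j\<in>J0. rep_perm N \<tau> (tr i j) (\<zeta> \<beta>) S) =
      kappa_indet * (\<Sum>j\<in>J1. rep_perm N \<tau> (tr i j) (\<zeta> (\<beta> \<circ> tr i j)) S)" for S
    using zeta_eigen[OF iN, of \<beta> S] i
    unfolding Ucal_multilinear_0[where \<beta> = \<beta>, OF zeta_Ptau zeta_multilinear iN b(1)] split c_def[symmetric]
    by (simp add: alpha_eq algebra_simps)
  \<comment> \<open>For \<open>i \<le> m\<close> the extra eigenvalue \<open>h_tau\<close> times
    \<open>\<kappa>\<^sub>0\<close> is 1, so the induced family satisfies the equation
    \<open>z\<close> with kappa specialised.\<close>
  have s: "(1 + \<kappa>\<^sub>0 * of_int c) * singular_vector \<beta> S - \<kappa>\<^sub>0 * (\<Sum>j\<in>J0. rep_perm N \<tau> (tr i j) (singular_vector \<beta>) S) =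
      \<kappa>\<^sub>0 * (\<Sum>j\<in>J1. rep_perm N \<tau> (tr i j) (singular_vector (\<beta> \<circ> tr i j)) S)" for S
  proof -
    have "\<kappa>\<^sub>0 * (\<Sum>j\<in>{i<..N}. rep_perm N \<tau> (tr i j) (singular_vector (\<beta> \<circ> tr i j)) S) =
        (1 + \<kappa>\<^sub>0 * of_int c) * singular_vector \<beta> S"
      unfolding singular_vector_jucys_murphy[OF iN] using i h_tau_pos by (simp add: alpha_eq c_def field_simps)
    then show ?thesis unfolding split by (simp add: algebra_simps)
  qed
  show ?thesis
  proof (rule fract_value_resolvent[OF P iN])
    show "J0 \<subseteq> {1..N} - {i}" using i by (auto simp: J0_def)
    show "fract_value \<kappa>\<^sub>0 (1 + kappa_indet * of_int c) (1 + \<kappa>\<^sub>0 * of_int c)"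
      by (intro fract_value_add fract_value_mult fract_value_1 fract_value_kappa fract_value_of_int)
    show "1 + \<kappa>\<^sub>0 * of_int c - \<kappa>\<^sub>0 * of_int (content \<tau> S n) \<noteq> 0" if "S \<in> RSYT N \<tau>" "n \<in> {1..N}" for S n
      unfolding c_def by (rule recursion_denominator_nonzero[OF that i])
    show "fract_value \<kappa>\<^sub>0 ((1 + kappa_indet * of_int c) * \<zeta> \<beta> S - kappa_indet * (\<Sum>j\<in>J0. rep_perm N \<tau> (tr i j) (\<zeta> \<beta>) S))
      ((1 + \<kappa>\<^sub>0 * of_int c) * singular_vector \<beta> S - \<kappa>\<^sub>0 * (\<Sum>j\<in>J0. rep_perm N \<tau> (tr i j) (singular_vector \<beta>) S))" for S
      unfolding z s
      by (intro fract_value_mult fract_value_kappa fract_value_sum fract_value_rep_perm IH) (auto simp: J1_def)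
  qed (use Ptau_Vspace[OF zeta_Ptau] singular_vector_Vspace fract_value_kappa in auto)
qed

text \<open>Induction on the sum of the occupied places. Exchanging a 0 at a place
  \<open>i \<le> m\<close> with a 1 further right lowers it. If no such 0 exists, all
  \<open>m\<close> ones are at 1, ..., m and the exponent is alpha.\<close>

lemma zeta_value_good:
  assumes "\<And>k. \<beta> k \<le> 1" "\<And>k. k \<notin> {1..N} \<Longrightarrow> \<beta> k = 0" "(\<Sum>k=1..N. \<beta> k) = m"
  shows "fract_value \<kappa>\<^sub>0 (\<zeta> \<beta> S) (singular_vector \<beta> S)"
  using assms
proof (induction "\<Sum>k=1..N. k * \<beta> k" arbitrary: \<beta> S rule: less_induct)
  case less
  show ?case
  proof (cases "\<exists>i\<in>{1..m}. \<beta> i = 0")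
    case False
    then have one: "\<beta> k = 1" if "k \<in> {1..m}" for k
      using less.prems(1)[of k] that by (metis le_SucE le_zero_eq One_nat_def)
    have "{1..N} = {1..m} \<union> {m<..N}" using m_less_N by auto
    then have "(\<Sum>k=1..N. \<beta> k) = (\<Sum>k=1..m. \<beta> k) + (\<Sum>k\<in>{m<..N}. \<beta> k)"
      by (simp only:) (rule sum.union_disjoint; auto)
    then have "(\<Sum>k\<in>{m<..N}. \<beta> k) = 0" using one less.prems(3) by simp
    then have "\<beta> k = alpha \<tau> k" for k
      using one[of k] less.prems(2)[of k] by (cases "k \<in> {1..N}") (auto simp: alpha_eq)
    then have "\<beta> = alpha \<tau>" by blast
    then show ?thesis by (simp add: zeta_alpha singular_vector_alpha fract_value_bvec)
  next
    case True
    then obtain i where i: "1 \<le> i" "i \<le> m" "\<beta> i = 0" by auto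
    show ?thesis
    proof (rule zeta_value_recursion[where \<beta> = \<beta>, OF i less.prems(1)])
      fix j S assume j: "i < j" "j \<le> N" "\<beta> j = 1"
      have ij: "i \<in> {1..N}" "j \<in> {1..N}" using i j by auto
      \<comment> \<open>Reindexing puts the transposition on the weights. As
        \<open>\<beta> i = 0\<close>, only the weight of \<open>j\<close> counts, and it drops to
        \<open>i\<close>.\<close>
      have "(\<Sum>k=1..N. k * (\<beta> \<circ> tr i j) k) = (\<Sum>k=1..N. tr i j k * \<beta> k)"
        using sum_comp_tr[OF ij, of "\<lambda>k. tr i j k * \<beta> k"] by simp
      also have "\<dots> < (\<Sum>k=1..N. k * \<beta> k)"
        using i j ij by (intro sum_strict_mono_ex1 ballI bexI[of _ j]) (auto simp: tr_def)
      finally show "fract_value \<kappa>\<^sub>0 (\<zeta> (\<beta> \<circ> tr i j) S) (singular_vector (\<beta> \<circ> tr i j) S)"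
      proof (rule less.hyps)
        show "(\<Sum>k=1..N. (\<beta> \<circ> tr i j) k) = m" using sum_comp_tr[OF ij, of \<beta>] less.prems(3) by simp
        show "(\<beta> \<circ> tr i j) k = 0" if "k \<notin> {1..N}" for k
          using that ij less.prems(2)[of k] by (auto simp: tr_def)
      qed (use less.prems(1) in simp)
    qed
  qed
qed

lemma zeta_value: "fract_value \<kappa>\<^sub>0 (\<zeta> \<beta> S) (singular_vector \<beta> S)"
proof (cases "\<zeta> \<beta> S = 0 \<and> singular_vector \<beta> S = 0")
  case True
  then show ?thesis by (simp add: fract_value_0)
next
  case False
  then consider "\<zeta> \<beta> S \<noteq> 0" | "singular_vector \<beta> S \<noteq> 0" by blast
  then show ?thesis
  proof cases
    case 1
    note support = nsJack_support[where \<zeta> = \<zeta> and \<gamma> = \<beta> and S = S, OF last_le J 1]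
    show ?thesis
    proof (rule zeta_value_good)
      show "\<beta> k \<le> 1" for k by (rule support(1))
      show "\<beta> k = 0" if "k \<notin> {1..N}" for k by (rule support(2)[OF that])
      show "(\<Sum>k=1..N. \<beta> k) = m" using support(3) by (simp only: alpha_last)
    qed
  next
    case 2
    show ?thesis
    proof (rule zeta_value_good)
      show "\<beta> k \<le> 1" for k by (rule singular_vector_range(1)[OF 2])
      show "\<beta> k = 0" if "k \<notin> {1..N}" for k by (rule singular_vector_range(2)[OF 2 that])
      show "(\<Sum>k=1..N. \<beta> k) = m" by (rule singular_vector_range(3)[OF 2])
    qed
  qed
qed

lemma singular_vector_Dunkl:
  assumes i: "i \<in> {1..N}"
  shows "Dunkl N \<tau> \<kappa>\<^sub>0 i singular_vector \<beta> S = 0"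
proof (cases "\<beta> i = 0")
  case True
  define \<gamma> where "\<gamma> = \<beta>(i := 1)"
  have g: "\<gamma> i = 1" by (simp add: \<gamma>_def)
  define c where "c = content \<tau> (T1 \<tau>) i"
  let ?F = singular_vector
  define A B C where "A = (\<Sum>j\<in>{1..N} - {i}. rep_perm N \<tau> (tr i j) (?F \<gamma>) S)"
    and "B = (\<Sum>j\<in>{1..<i}. rep_perm N \<tau> (tr i j) (?F (\<gamma> \<circ> tr i j)) S)"
    and "C = (\<Sum>j\<in>{i<..N}. rep_perm N \<tau> (tr i j) (?F (\<gamma> \<circ> tr i j)) S)"
  \<comment> \<open>The same coefficient of U_i zeta is specialised in two ways, from the formula
    for U_i and from the eigenvalue equation. Uniqueness of the value yields the equation for the
    induced family.\<close>
  have "fract_value \<kappa>\<^sub>0 (Ucal N \<tau> kappa_indet i \<zeta> \<gamma> S) (2 * ?F \<gamma> S + \<kappa>\<^sub>0 * A - \<kappa>\<^sub>0 * B)"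
    unfolding Ucal_multilinear_1[where \<beta> = \<gamma>, OF zeta_Ptau zeta_multilinear i g] A_def B_def
    by (intro fract_value_add fract_value_diff fract_value_mult fract_value_kappa fract_value_sum fract_value_rep_perm zeta_value)
      (use fract_value_of_nat[of _ 2] in simp)
  moreover have "fract_value \<kappa>\<^sub>0 (Ucal N \<tau> kappa_indet i \<zeta> \<gamma> S)
      ((of_nat (alpha \<tau> i) + 1 + \<kappa>\<^sub>0 * of_int c) * ?F \<gamma> S)"
    unfolding zeta_eigen[OF i] c_def
    by (intro fract_value_add fract_value_mult fract_value_kappa fract_value_of_nat fract_value_of_int fract_value_1 zeta_value)
  ultimately have U: "2 * ?F \<gamma> S + \<kappa>\<^sub>0 * A - \<kappa>\<^sub>0 * B = (of_nat (alpha \<tau> i) + 1 + \<kappa>\<^sub>0 * of_int c) * ?F \<gamma> S"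
    by (rule fract_value_unique)
  \<comment> \<open>Here \<open>\<kappa>\<^sub>0\<close> times \<open>h_tau\<close> is 1, so the
    shift of the content becomes the summand alpha_i that also occurs in the eigenvalue of U_i; in
    the difference the two cancel.\<close>
  have W: "\<kappa>\<^sub>0 * C = (\<kappa>\<^sub>0 * of_int c + real (alpha \<tau> i)) * ?F \<gamma> S"
    using h_tau_pos unfolding C_def singular_vector_jucys_murphy[OF i] c_def by (simp add: field_simps)
  define D where "D = (\<Sum>j\<in>{1..N} - {i}. rep_perm N \<tau> (tr i j) (?F (\<gamma> \<circ> tr i j)) S)"
  have split: "{1..N} - {i} = {1..<i} \<union> {i<..N}" using i by auto
  have D: "D = B + C" unfolding D_def B_def C_def split by (rule sum.union_disjoint) auto
  have "Dunkl N \<tau> \<kappa>\<^sub>0 i ?F \<beta> S = ?F \<gamma> S + \<kappa>\<^sub>0 * (A - D)"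
  proof -
    have "Dunkl N \<tau> \<kappa>\<^sub>0 i ?F \<beta> S = ?F \<gamma> S + \<kappa>\<^sub>0 * (\<Sum>j\<in>{1..N} - {i}.
        rep_perm N \<tau> (tr i j) (?F \<gamma>) S - rep_perm N \<tau> (tr i j) (?F (\<gamma> \<circ> tr i j)) S)"
      using Dunkl_multilinear[OF singular_vector_Ptau singular_vector_multilinear, of \<kappa>\<^sub>0 i \<beta> S]
      unfolding if_P[OF True] Let_def \<gamma>_def .
    then show ?thesis unfolding A_def D_def sum_subtractf .
  qed
  also have "\<dots> = (2 * ?F \<gamma> S + \<kappa>\<^sub>0 * A - \<kappa>\<^sub>0 * B) - ?F \<gamma> S - \<kappa>\<^sub>0 * C"
    unfolding D by (simp add: algebra_simps add_divide_distrib diff_divide_distrib)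
  also have "\<dots> = 0" unfolding U W by (simp add: algebra_simps)
  finally show ?thesis .
qed (simp add: Dunkl_multilinear[OF singular_vector_Ptau singular_vector_multilinear])

end

end

theorem theorem7p4:
  fixes N :: nat and \<tau> :: "nat list" and \<zeta> :: "real poly fract ptau"
  assumes "is_partition N \<tau>" and "length \<tau> \<ge> 2"
    and "is_nsJack N \<tau> kappa_indet (alpha \<tau>) (T1 \<tau>) \<zeta>"
  shows "(\<forall>\<beta> T. regular_at (1 / real (h_tau \<tau>)) (\<zeta> \<beta> T)) \<and>
         (\<forall>i\<in>{1..N}. Dunkl N \<tau> (1 / real (h_tau \<tau>)) i
             (\<lambda>\<beta> T. eval_at (1 / real (h_tau \<tau>)) (\<zeta> \<beta> T)) = (\<lambda>\<beta> T. 0))"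
proof -
  obtain a rest where "\<tau> = a # rest" "rest \<noteq> []"
    using assms(2) by (cases \<tau>) (auto simp: Suc_le_eq)
  then have tau: "\<tau> = a # butlast rest @ [last rest]" by simp
  interpret bottom_row_move N a "butlast rest" "last rest" \<tau> "(a + last rest) # butlast rest"
    using assms(1) tau by unfold_locales auto
  have v: "regular_at (1 / real (h_tau \<tau>)) (\<zeta> \<beta> T)" "eval_at (1 / real (h_tau \<tau>)) (\<zeta> \<beta> T) = singular_vector \<beta> T"
    for \<beta> T
    using fract_value_eval[OF zeta_value[OF assms(3)]] by auto
  then show ?thesis using singular_vector_Dunkl[OF assms(3)] by (simp add: fun_eq_iff)
qed

end
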